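(* Let $c(n)=m\mu(k)$ when $n=m^2k$ with $k$ squarefree. Then the series $\sum_{n=1}^\infty \frac{c(n)}{n}$ converges and \[\sum_{n=1}^\infty\frac{c(n)}{n}=\frac12.\]
   Context: $\mu$ is the Möbius function. Equivalently, $c(n)$ is defined by $\sum_{n\ge1}c(n)n^{-s}=\zeta(2s-1)/\zeta(s)$ for $\operatorname{Re}(s)>1$. *)

theory Defs
  imports "HOL-Analysis.Analysis" "HOL-Computational_Algebra.Squarefree"
begin

definition moebius :: "nat \<Rightarrow> int" where
  "moebius n = (if squarefree n then (- 1) ^ card (prime_factors n) else 0)"

text \<open>
  The decomposition of \<open>n > 0\<close> as \<open>m\<^sup>2 * k\<close> with \<open>k\<close> squarefree is unique, with
  \<open>m = square_part n\<close> and \<open>k = squarefree_part n\<close>; see \<open>c_mult_squarefree\<close> below.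
\<close>

definition c :: "nat \<Rightarrow> int" where
  "c n = int (square_part n) * moebius (squarefree_part n)"

lemma square_part_mult_squarefree:
  fixes m k :: nat
  assumes "squarefree k" "m > 0"
  shows "square_part (m ^ 2 * k) = m"
proof (rule multiplicity_eq_nat)
  have k: "k \<noteq> 0" using assms(1) by (rule contrapos_pn) simp
  show "square_part (m ^ 2 * k) > 0" using k assms by (intro Nat.gr0I) simp
  fix p :: nat assume p: "prime p"
  have "multiplicity p k \<le> 1"
    using assms(1) k p squarefree_factorial_semiring'[of k]
    by (cases "p \<in> prime_factors k") (auto simp: prime_factors_multiplicity)
  then show "multiplicity p (square_part (m ^ 2 * k)) = multiplicity p m"
    using p k assms(2)
    by (simp add: prime_multiplicity_square_part prime_elem_multiplicity_mult_distrib
        prime_elem_multiplicity_power_distrib)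
qed (use assms in auto)

lemma c_mult_squarefree:
  fixes m k :: nat
  assumes "squarefree k" "m > 0"
  shows "c (m ^ 2 * k) = int m * moebius k"
proof -
  have "squarefree_part (m ^ 2 * k) = k"
    using squarefree_decompose[of "m ^ 2 * k"] assms
    by (simp add: square_part_mult_squarefree)
  then show ?thesis by (simp add: c_def square_part_mult_squarefree assms)
qed

end

theory Submission
  imports Defs "HOL-Complex_Analysis.Complex_Analysis"
begin

text \<open>
  Grouping \<open>n = m\<^sup>2 k\<close>, the partial sums are \<open>\<Sum> \<mu>(k) / (m k)\<close> over \<open>m\<^sup>2 k \<le> N\<close>. The hyperbola method
  and \<open>\<Sum>\<^bsub>m \<le> y\<^esub> 1/m = ln y + \<gamma> + O(1/y)\<close> reduce the claim to the two limits
  \<open>P(x) = \<Sum>\<^bsub>k \<le> x\<^esub> \<mu>(k)/k ln (x/k) \<longlonglongrightarrow> 1\<close> and \<open>M(x) = \<Sum>\<^bsub>k \<le> x\<^esub> \<mu>(k)/k \<longlonglongrightarrow> 0\<close>; the value \<open>1/2\<close> is the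
  factor in \<open>ln (N/k) / 2\<close>.

  Since \<open>P(e\<^sup>T)\<close> is the integral of the bounded function \<open>M(e\<^sup>t)\<close> over \<open>[0, T]\<close>, whose Laplace transform is
  \<open>1 / (z \<zeta>(1 + z))\<close>, Newman's Tauberian theorem gives \<open>P \<longlonglongrightarrow> 1\<close> once \<open>\<zeta>\<close> is known not to vanish on
  \<open>Re s = 1\<close>. As \<open>M\<close> varies slowly, \<open>M(x)\<close> is close to the difference quotient of \<open>P\<close> between \<open>ln x\<close>
  and \<open>ln x + \<delta>\<close>, hence tends to \<open>0\<close>.
\<close>

section \<open>The Moebius function\<close>

text \<open>The value is what \<open>zeta(2s - 1) / zeta(s)\<close> suggests at s = 1, where a
  simple pole with residue 1/2 meets a simple zero with derivative 1. Convergence is the real issue: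
  the terms with n a square already contribute the harmonic series, so the series is not absolutely
  convergent and cancellation in mu, of the depth of the prime number theorem, has to enter. No rate
  for that cancellation is needed. The hyperbola is cut at a parameter that does not depend on N:
  the error is then small uniformly in N, and what remains involves only finitely many values of the
  two sums, each at a constant multiple of N. Their bare limits suffice. Newman's theorem fits
  because its only a priori input, boundedness of the sums of mu(k)/k, is elementary, and because
  the factor z in z * zeta(1 + z) cancels the pole of zeta. For this reason everything is phrased
  with (s - 1) * zeta(s), which is holomorphic at 1 with value 1.\<close>

lemma moebius_1 [simp]: "moebius (Suc 0) = 1"
  by (simp add: moebius_def)

lemma abs_moebius_le_1: "\<bar>moebius n\<bar> \<le> 1"
  by (simp add: moebius_def power_abs)

lemma moebius_prime_mult:
  assumes "prime p" "\<not> p dvd d"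
  shows "moebius (p * d) = - moebius d"
proof (cases "squarefree d")
  case True
  have d: "d \<noteq> 0" using True by (rule contrapos_pn) simp
  have "coprime p d" using assms by (simp add: prime_imp_coprime)
  hence sf: "squarefree (p * d)"
    using True assms(1) by (simp add: squarefree_mult_coprime squarefree_prime)
  have "prime_factors (p * d) = insert p (prime_factors d)"
    using assms d by (simp add: prime_factors_product prime_prime_factors prime_gt_0_nat)
  moreover have "p \<notin> prime_factors d"
    using assms(2) by auto
  ultimately show ?thesis using True sf by (simp add: moebius_def)
next
  case False
  hence "\<not> squarefree (p * d)"
    using squarefree_mono[of d "p * d"] by auto
  thus ?thesis using False by (simp add: moebius_def)
qed

text \<open>For n > 1 fix a prime p dividing n. Only squarefree divisors count, and multiplication
  by p pairs those not divisible by p with those divisible by p, reversing the sign of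
  \<open>moebius\<close>.\<close>

lemma sum_moebius_divisors:
  assumes "n > 0"
  shows "(\<Sum>d | d dvd n. moebius d) = (if n = 1 then 1 else 0)"
proof (cases "n = 1")
  case False
  obtain p where p: "prime p" "p dvd n"
    using False prime_factor_nat by blast
  have fin: "finite {d. d dvd n}" using assms by simp
  let ?A = "{d. d dvd n \<and> squarefree d \<and> \<not> p dvd d}"
  let ?B = "{d. d dvd n \<and> squarefree d \<and> p dvd d}"
  have "(\<Sum>d | d dvd n. moebius d) = (\<Sum>d \<in> ?A \<union> ?B. moebius d)"
    by (rule sum.mono_neutral_right) (use fin in \<open>auto simp: moebius_def\<close>)
  also have "\<dots> = (\<Sum>d \<in> ?A. moebius d) + (\<Sum>d \<in> ?B. moebius d)"
    by (rule sum.union_disjoint) (use assms in \<open>auto intro: finite_subset[OF _ fin]\<close>)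
  also have "(\<Sum>d \<in> ?B. moebius d) = (\<Sum>d \<in> ?A. - moebius d)"
  proof (rule sum.reindex_bij_witness[of _ "\<lambda>d. p * d" "\<lambda>d. d div p"])
    fix d assume "d \<in> ?B"
    then obtain e where e: "d = p * e" and d: "d dvd n" "squarefree d" by auto
    have np: "\<not> p dvd e"
    proof
      assume "p dvd e"
      hence "p ^ 2 dvd d" by (auto simp: e power2_eq_square)
      thus False using d(2) p(1) by (meson squarefreeD not_prime_unit)
    qed
    show "p * (d div p) = d" using e by simp
    show "d div p \<in> ?A"
      using d e np p(1) squarefree_mono[of e d] by (auto intro: dvd_mult_right)
    show "- moebius (d div p) = moebius d"
      using e np p(1) moebius_prime_mult by auto
  next
    fix d assume d: "d \<in> ?A"
    show "p * d div p = d" using p(1) by (simp add: prime_gt_0_nat)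
    have "coprime p d" using d p(1) by (simp add: prime_imp_coprime)
    thus "p * d \<in> ?B" using d p
      by (simp add: divides_mult squarefree_mult_coprime squarefree_prime)
  qed
  finally show ?thesis using False by (simp add: sum_negf)
qed simp

section \<open>The elementary bound on the sums of mu(k)/k\<close>

definition moebius_sum :: "real \<Rightarrow> real" where
  "moebius_sum x = (\<Sum>k = 1..nat \<lfloor>x\<rfloor>. real_of_int (moebius k) / real k)"

lemma card_multiples:
  assumes "d > (0::nat)"
  shows "card {j \<in> {1..n}. d dvd j} = n div d"
proof -
  have "{j \<in> {1..n}. d dvd j} = (\<lambda>i. d * i) ` {1..n div d}"
    using assms by (auto simp: image_iff less_eq_div_iff_mult_less_eq mult.commute elim!: dvdE)
  moreover have "inj_on (\<lambda>i. d * i) {1..n div d}"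
    using assms by (auto simp: inj_on_def)
  ultimately show ?thesis by (simp add: card_image)
qed

text \<open>\<open>n div k\<close> is the number of multiples j of k up to n. Swapping the sums over
  k and j leaves a divisor sum of \<open>moebius\<close> for each j, and only j = 1
  survives.\<close>

lemma sum_moebius_div:
  assumes "n > 0"
  shows "(\<Sum>k = 1..n. moebius k * int (n div k)) = 1"
proof -
  have "(\<Sum>k = 1..n. moebius k * int (n div k)) = (\<Sum>k = 1..n. \<Sum>j | j \<in> {1..n} \<and> k dvd j. moebius k)"
    by (intro sum.cong refl) (use card_multiples in simp)
  also have "\<dots> = (\<Sum>j = 1..n. \<Sum>k | k \<in> {1..n} \<and> k dvd j. moebius k)"
    by (rule sum.swap_restrict) auto
  also have "\<dots> = (\<Sum>j = 1..n. if j = 1 then 1 else 0)"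
  proof (intro sum.cong refl)
    fix j assume j: "j \<in> {1..n}"
    hence "{k. k \<in> {1..n} \<and> k dvd j} = {k. k dvd j}"
      using dvd_imp_le[of _ j] by (fastforce simp: Suc_le_eq dest: dvd_pos_nat[rotated])
    thus "(\<Sum>k | k \<in> {1..n} \<and> k dvd j. moebius k) = (if j = 1 then 1 else 0)"
      using sum_moebius_divisors[of j] j by simp
  qed
  also have "\<dots> = 1" using assms by (simp add: sum.delta)
  finally show ?thesis .
qed

text \<open>Replacing \<open>n div k\<close> by n / k in \<open>sum_moebius_div\<close> costs the
  fractional parts \<open>r k\<close>. The one at k = 1 is zero, so n * \<open>moebius_sum x\<close>
  is 1 plus n - 1 terms of modulus at most 1.\<close>

lemma abs_moebius_sum_le_1: "\<bar>moebius_sum x\<bar> \<le> 1"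
proof (cases "nat \<lfloor>x\<rfloor> = 0")
  case False
  define n where "n = nat \<lfloor>x\<rfloor>"
  have n: "n > 0" using False by (simp add: n_def)
  define r where "r = (\<lambda>k. real n / real k - real (n div k))"
  have r: "0 \<le> r k" "r k \<le> 1" for k
    using floor_divide_of_nat_eq[of n k, where ?'a = real] by (simp_all add: r_def) linarith+
  have "real n * moebius_sum x = (\<Sum>k = 1..n. moebius k * real (n div k)) + (\<Sum>k = 1..n. moebius k * r k)"
    by (simp add: moebius_sum_def n_def r_def sum_distrib_left algebra_simps flip: sum.distrib)
  also have "(\<Sum>k = 1..n. moebius k * real (n div k)) = 1"
    using arg_cong[OF sum_moebius_div[OF n], of real_of_int] by simp
  also have "(\<Sum>k = 1..n. moebius k * r k) = (\<Sum>k = 2..n. moebius k * r k)"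
    using n by (subst sum.atLeast_Suc_atMost) (auto simp: r_def numeral_2_eq_2)
  finally have eq: "real n * moebius_sum x = 1 + (\<Sum>k = 2..n. moebius k * r k)" .
  have "\<bar>\<Sum>k = 2..n. moebius k * r k\<bar> \<le> (\<Sum>k = 2..n. 1)"
  proof (rule order.trans[OF sum_abs], rule sum_mono)
    fix k
    have "\<bar>real_of_int (moebius k)\<bar> \<le> 1" using abs_moebius_le_1[of k] by linarith
    thus "\<bar>moebius k * r k\<bar> \<le> 1" using r[of k] by (simp add: abs_mult mult_le_one)
  qed
  also have "\<dots> = real n - 1" using n by (simp add: of_nat_diff)
  finally have "real n * \<bar>moebius_sum x\<bar> \<le> real n * 1"
    using arg_cong[OF eq, of abs] by (simp add: abs_mult)
  thus ?thesis using n by simp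
qed (simp add: moebius_sum_def)

text \<open>Absolute summability permits regrouping the double sum over (d, e) by the product n = d
  * e; the pair is recovered from n and its divisor d.\<close>

lemma dirichlet_product_has_sum:
  fixes a b :: "nat \<Rightarrow> complex"
  assumes "(a has_sum s) {1..}" "(\<lambda>n. norm (a n)) summable_on {1..}"
    and "(b has_sum t) {1..}" "(\<lambda>n. norm (b n)) summable_on {1..}"
  shows "((\<lambda>n. \<Sum>d | d dvd n. a d * b (n div d)) has_sum s * t) {1..}"
proof -
  have "(\<lambda>x. norm ((\<lambda>(d, e). a d * b e) x)) summable_on {1..} \<times> {1..}"
    by (rule summable_on_SigmaI[where g = "\<lambda>d. norm (a d) * (\<Sum>\<^sub>\<infinity>e\<in>{1..}. norm (b e))"])
       (use assms in \<open>auto simp: norm_mult intro: has_sum_cmult_right summable_on_cmult_left\<close>)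
  hence sm: "(\<lambda>(d, e). a d * b e) summable_on {1..} \<times> {1..}"
    by (rule abs_summable_summable)
  have "((\<lambda>(d, e). a d * b e) has_sum s * t) ({1..} \<times> {1..})"
    by (rule has_sum_SigmaI[where g = "\<lambda>d. a d * t"])
       (use assms sm in \<open>auto intro: has_sum_cmult_right has_sum_cmult_left\<close>)
  also have "?this \<longleftrightarrow> ((\<lambda>(n, d). a d * b (n div d)) has_sum s * t) (SIGMA n:{1..}. {d. d dvd n})"
    by (rule has_sum_reindex_bij_witness[of _ "\<lambda>(n, d). (d, n div d)" "\<lambda>(d, e). (d * e, d)"])
       (auto simp: Suc_le_eq dvd_div_eq_0_iff intro: Nat.gr0I)
  finally have "((\<lambda>(n, d). a d * b (n div d)) has_sum s * t) (SIGMA n:{1..}. {d. d dvd n})" .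
  thus ?thesis
    by (rule has_sum_SigmaD) (auto intro!: has_sum_finite)
qed

section \<open>The zeta function\<close>

lemma norm_of_nat_powr: "norm (of_nat n powr (s::complex)) = real n powr Re s"
  by (simp add: norm_powr_real_powr)

definition zeta_term :: "nat \<Rightarrow> complex \<Rightarrow> complex" where
  "zeta_term n s = (s - 1) * of_nat n powr (- s) - of_nat n powr (1 - s) + of_nat (Suc n) powr (1 - s)"

text \<open>
  This is \<open>(s - 1) \<zeta>(s)\<close>: the terms \<open>n\<^bsup>1-s\<^esup>\<close> telescope for \<open>Re s > 1\<close>, and they make the series converge
  for \<open>Re s > 0\<close>.
\<close>

definition reg_zeta :: "complex \<Rightarrow> complex" where
  "reg_zeta s = 1 + (\<Sum>n. zeta_term (Suc n) s)"

text \<open>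
  \<open>zeta_term n s\<close> is the increment over \<open>[n, n + 1]\<close> of \<open>\<phi>(x) = (s - 1) x n\<^bsup>-s\<^esup> + x\<^bsup>1-s\<^esup>\<close>, whose derivative
  vanishes at \<open>x = n\<close>; so the mean value inequality applies twice.
\<close>

lemma norm_zeta_term_le:
  assumes n: "n > 0" and s: "Re s > 0"
  shows "norm (zeta_term n s) \<le> norm (s - 1) * norm s * real n powr (- Re s - 1)"
proof -
  define S where "S = closed_segment (of_nat n) (of_nat (Suc n) :: complex)"
  have S: "\<exists>x. z = of_real x \<and> real n \<le> x \<and> x \<le> real (Suc n)" if z: "z \<in> S" for z
  proof -
    obtain u where u: "0 \<le> u" "u \<le> 1" "z = (1 - u) *\<^sub>R of_nat n + u *\<^sub>R of_nat (Suc n)"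
      using z by (auto simp: S_def closed_segment_def)
    have "z = of_real (real n + u)"
      using u(3) by (simp add: scaleR_conv_of_real algebra_simps)
    thus ?thesis using u by (intro exI[of _ "real n + u"]) auto
  qed
  have nonneg: "z \<notin> \<real>\<^sub>\<le>\<^sub>0" if "z \<in> S" for z
    using S[OF that] n by auto
  have ends: "of_nat n \<in> S" "of_nat (Suc n) \<in> S" by (auto simp: S_def simp del: of_nat_Suc)
  have conv: "convex S" by (simp add: S_def)
  have 1: "norm (z powr (- s) - of_nat n powr (- s)) \<le> norm s * real n powr (- Re s - 1)" if z: "z \<in> S" for z
  proof -
    have "norm (z powr (- s) - of_nat n powr (- s)) \<le> (norm s * real n powr (- Re s - 1)) * norm (z - of_nat n)"
    proof (rule field_differentiable_bound[OF conv _ _ z ends(1), where f' = "\<lambda>w. - s * w powr (- s - 1)"])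
      fix w assume w: "w \<in> S"
      show "((\<lambda>w. w powr - s) has_field_derivative - s * w powr (- s - 1)) (at w within S)"
        by (rule has_field_derivative_at_within[OF has_field_derivative_powr[OF nonneg[OF w]]])
      obtain x where x: "w = of_real x" "real n \<le> x" using S[OF w] by auto
      have "norm (w powr (- s - 1)) = x powr (- Re s - 1)"
        using x n by (simp add: norm_powr_real_powr)
      also have "\<dots> \<le> real n powr (- Re s - 1)"
        using x n s by (intro powr_mono2') auto
      finally show "norm (- s * w powr (- s - 1)) \<le> norm s * real n powr (- Re s - 1)"
        by (simp add: norm_mult mult_left_mono)
    qed
    also have "norm (z - of_nat n) \<le> 1"
    proof -
      obtain x where x: "z = of_real x" "real n \<le> x" "x \<le> real (Suc n)" using S[OF z] by auto
      have "z - of_nat n = of_real (x - real n)" using x by simp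
      thus ?thesis using x by (simp only: norm_of_real)
    qed
    finally show ?thesis by (simp add: mult_left_mono)
  qed
  define \<phi> where "\<phi> = (\<lambda>z. (s - 1) * z * of_nat n powr (- s) + z powr (1 - s))"
  have "norm (\<phi> (of_nat (Suc n)) - \<phi> (of_nat n)) \<le>
      (norm (s - 1) * (norm s * real n powr (- Re s - 1))) * norm (of_nat (Suc n) - of_nat n :: complex)"
  proof (rule field_differentiable_bound[OF conv _ _ ends(2,1),
           where f' = "\<lambda>w. (s - 1) * of_nat n powr (- s) + (1 - s) * w powr (- s)"])
    fix w assume w: "w \<in> S"
    show "(\<phi> has_field_derivative (s - 1) * of_nat n powr (- s) + (1 - s) * w powr (- s)) (at w within S)"
      unfolding \<phi>_def
      by (rule has_field_derivative_at_within)
         (use nonneg[OF w] in \<open>auto intro!: derivative_eq_intros\<close>)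
    have "(s - 1) * of_nat n powr (- s) + (1 - s) * w powr (- s) = (1 - s) * (w powr (- s) - of_nat n powr (- s))"
      by (simp add: algebra_simps)
    thus "norm ((s - 1) * of_nat n powr (- s) + (1 - s) * w powr (- s)) \<le> norm (s - 1) * (norm s * real n powr (- Re s - 1))"
      using 1[OF w] by (simp add: norm_mult norm_minus_commute mult_left_mono)
  qed
  also have "\<phi> (of_nat (Suc n)) - \<phi> (of_nat n) = zeta_term n s"
    by (simp add: \<phi>_def zeta_term_def algebra_simps)
  finally show ?thesis by (simp add: mult.assoc)
qed

lemma summable_zeta_term:
  assumes "Re s > 0"
  shows "summable (\<lambda>n. zeta_term (Suc n) s)"
proof (rule summable_comparison_test)
  show "summable (\<lambda>n. norm (s - 1) * norm s * real (Suc n) powr (- Re s - 1))"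
    using assms by (intro summable_mult) (subst summable_Suc_iff, simp add: summable_real_powr_iff)
  show "\<exists>N. \<forall>n\<ge>N. norm (zeta_term (Suc n) s) \<le> norm (s - 1) * norm s * real (Suc n) powr (- Re s - 1)"
    using norm_zeta_term_le[OF _ assms] by blast
qed

lemma reg_zeta_holomorphic: "reg_zeta holomorphic_on {s. Re s > 0}"
proof -
  have "(\<lambda>s. \<Sum>n. zeta_term (Suc n) s) holomorphic_on {s. Re s > 0}"
  proof (rule holomorphic_uniform_sequence[where f = "\<lambda>N s. \<Sum>n<N. zeta_term (Suc n) s"])
    show "open {s. Re s > 0}" by (rule open_halfspace_Re_gt)
    show "(\<lambda>s. \<Sum>n<N. zeta_term (Suc n) s) holomorphic_on {s. Re s > 0}" for N
      unfolding zeta_term_def by (intro holomorphic_intros) (auto simp del: of_nat_Suc)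
    fix s :: complex assume "s \<in> {s. Re s > 0}"
    hence s: "Re s > 0" by simp
    \<comment> \<open>Half of the real part keeps the whole ball in Re z \<ge> d, where the terms
      are dominated by a multiple of \<open>real (Suc n) powr (- d - 1)\<close>.\<close>
    define d where "d = Re s / 2"
    define K where "K = norm s + d"
    have bnd: "Re z \<ge> d" "norm z \<le> K" "norm (z - 1) \<le> K + 1" if z: "z \<in> cball s d" for z
    proof -
      have 1: "norm (s - z) \<le> d" using z by (simp add: dist_norm)
      have "Re (s - z) \<le> d" using 1 complex_Re_le_cmod[of "s - z"] by linarith
      thus "Re z \<ge> d" by (simp add: d_def)
      show 2: "norm z \<le> K" using 1 norm_triangle_ineq4[of s "s - z"] by (simp add: K_def)
      show "norm (z - 1) \<le> K + 1" using 2 norm_triangle_ineq4[of z 1] by simp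
    qed
    have d: "d > 0" "K \<ge> 0" using s by (auto simp: d_def K_def)
    have "uniform_limit (cball s d) (\<lambda>N s. \<Sum>n<N. zeta_term (Suc n) s) (\<lambda>s. \<Sum>n. zeta_term (Suc n) s) sequentially"
    proof (rule Weierstrass_m_test)
      show "summable (\<lambda>n. (K + 1) * K * real (Suc n) powr (- d - 1))"
        using d by (intro summable_mult) (subst summable_Suc_iff, simp add: summable_real_powr_iff)
      fix n z assume z: "z \<in> cball s d"
      have "norm (zeta_term (Suc n) z) \<le> norm (z - 1) * norm z * real (Suc n) powr (- Re z - 1)"
        using bnd[OF z] d by (intro norm_zeta_term_le) auto
      also have "\<dots> \<le> (K + 1) * K * real (Suc n) powr (- d - 1)"
        using bnd[OF z] d by (intro mult_mono powr_mono) auto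
      finally show "norm (zeta_term (Suc n) z) \<le> (K + 1) * K * real (Suc n) powr (- d - 1)" .
    qed
    moreover have "cball s d \<subseteq> {s. Re s > 0}" using bnd(1) d by force
    ultimately show "\<exists>d>0. cball s d \<subseteq> {s. Re s > 0} \<and>
      uniform_limit (cball s d) (\<lambda>N s. \<Sum>n<N. zeta_term (Suc n) s) (\<lambda>s. \<Sum>n. zeta_term (Suc n) s) sequentially"
      using d by blast
  qed
  thus ?thesis unfolding reg_zeta_def by (intro holomorphic_intros)
qed

lemma reg_zeta_1 [simp]: "reg_zeta 1 = 1"
  by (simp add: reg_zeta_def zeta_term_def del: of_nat_Suc)

section \<open>Dirichlet series of zeta and of its reciprocal\<close>

lemma has_sum_from_1_iff: "(f has_sum S) {1..} \<longleftrightarrow> ((\<lambda>n. f (Suc n)) has_sum S) UNIV"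
proof -
  have "{1..} = range Suc" by (auto simp: image_iff Suc_le_eq gr0_conv_Suc)
  thus ?thesis by (simp add: has_sum_reindex o_def)
qed

lemma norm_powr_summable_on:
  assumes "Re s > 1"
  shows "(\<lambda>n. norm (of_nat n powr (- s))) summable_on {1..}"
proof -
  have "summable (\<lambda>n. real (Suc n) powr (- Re s))"
    by (subst summable_Suc_iff) (use assms in \<open>simp add: summable_real_powr_iff\<close>)
  hence "((\<lambda>n. real (Suc n) powr (- Re s)) has_sum (\<Sum>n. real (Suc n) powr (- Re s))) UNIV"
    by (intro norm_summable_imp_has_sum) (auto simp: summable_sums simp del: of_nat_Suc)
  thus ?thesis
    unfolding summable_on_def has_sum_from_1_iff norm_of_nat_powr by (intro exI) simp
qed

lemma zeta_has_sum:
  assumes "Re s > 1"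
  shows "((\<lambda>n. of_nat n powr (- s)) has_sum (reg_zeta s / (s - 1))) {1..}"
proof -
  have s1: "s \<noteq> 1" using assms by auto
  have "(\<lambda>n. of_nat (Suc n) powr (1 - s)) \<longlonglongrightarrow> 0"
  proof (rule tendsto_norm_zero_cancel, unfold norm_of_nat_powr)
    have "((\<lambda>n. real n powr (Re (1 - s))) \<longlongrightarrow> 0) sequentially"
      using assms by (intro tendsto_neg_powr filterlim_real_sequentially) auto
    thus "(\<lambda>n. real (Suc n) powr (Re (1 - s))) \<longlonglongrightarrow> 0" by (rule LIMSEQ_Suc)
  qed
  \<comment> \<open>The telescoped terms sum to 1, which accounts for the leading 1 in
    \<open>reg_zeta\<close>.\<close>
  hence "(\<lambda>n. of_nat (Suc n) powr (1 - s) - of_nat (Suc (Suc n)) powr (1 - s)) sums (of_nat (Suc 0) powr (1 - s) - 0)"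
    by (rule telescope_sums')
  moreover have "(\<lambda>n. zeta_term (Suc n) s) sums (reg_zeta s - 1)"
    using summable_sums[OF summable_zeta_term[of s]] assms by (simp add: reg_zeta_def)
  ultimately have "(\<lambda>n. (of_nat (Suc n) powr (1 - s) - of_nat (Suc (Suc n)) powr (1 - s)) + zeta_term (Suc n) s) sums
      ((of_nat (Suc 0) powr (1 - s) - 0) + (reg_zeta s - 1))"
    by (rule sums_add)
  hence "(\<lambda>n. (s - 1) * of_nat (Suc n) powr (- s)) sums reg_zeta s"
    by (simp add: zeta_term_def del: of_nat_Suc) simp
  from sums_divide[OF this, of "s - 1"] have "(\<lambda>n. of_nat (Suc n) powr (- s)) sums (reg_zeta s / (s - 1))"
    using s1 by (simp del: of_nat_Suc)
  moreover have "summable (\<lambda>n. norm (of_nat (Suc n) powr (- s)))"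
    unfolding norm_of_nat_powr
    by (subst summable_Suc_iff) (use assms in \<open>simp add: summable_real_powr_iff\<close>)
  ultimately show ?thesis
    unfolding has_sum_from_1_iff by (intro norm_summable_imp_has_sum)
qed

lemma of_nat_mult_powr: "of_nat (m * n) powr (s::complex) = of_nat m powr s * of_nat n powr s"
  by (simp add: powr_times_real)

text \<open>The divisor sums of \<open>moebius\<close> vanish beyond n = 1, so the product of the
  two Dirichlet series is 1. With m for the Moebius series this reads
  \<open>m * reg_zeta s = s - 1\<close>; since s - 1 is nonzero, it yields the nonvanishing together
  with the value of m.\<close>

lemma moebius_has_sum:
  assumes s: "Re s > 1"
  shows "reg_zeta s \<noteq> 0"
    and "((\<lambda>n. of_int (moebius n) * of_nat n powr (- s)) has_sum ((s - 1) / reg_zeta s)) {1..}"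
proof -
  let ?a = "\<lambda>n. of_int (moebius n) * of_nat n powr (- s)"
  have na: "(\<lambda>n. norm (?a n)) summable_on {1..}"
  proof (rule summable_on_comparison_test[OF norm_powr_summable_on[OF s]])
    fix n :: nat
    have "\<bar>real_of_int (moebius n)\<bar> \<le> 1" using abs_moebius_le_1[of n] by linarith
    thus "norm (?a n) \<le> norm (of_nat n powr (- s))"
      by (simp add: norm_mult mult_left_le_one_le)
  qed auto
  hence "?a summable_on {1..}" by (rule abs_summable_summable)
  then obtain m where m: "(?a has_sum m) {1..}" unfolding summable_on_def by (rule exE)
  have "((\<lambda>n. \<Sum>d | d dvd n. ?a d * of_nat (n div d) powr (- s)) has_sum m * (reg_zeta s / (s - 1))) {1..}"
    by (rule dirichlet_product_has_sum[OF m na zeta_has_sum[OF s] norm_powr_summable_on[OF s]])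
  also have "?this \<longleftrightarrow> ((\<lambda>n::nat. if n = 1 then 1 else 0) has_sum m * (reg_zeta s / (s - 1))) {1..}"
  proof (rule has_sum_cong)
    fix n :: nat assume n: "n \<in> {1..}"
    have "(\<Sum>d | d dvd n. ?a d * of_nat (n div d) powr (- s)) = (\<Sum>d | d dvd n. of_int (moebius d) * of_nat n powr (- s))"
    proof (rule sum.cong)
      fix d assume "d \<in> {d. d dvd n}"
      hence "n = d * (n div d)" by simp
      thus "?a d * of_nat (n div d) powr (- s) = of_int (moebius d) * of_nat n powr (- s)"
        by (metis mult.assoc of_nat_mult_powr)
    qed simp
    also have "\<dots> = of_int (\<Sum>d | d dvd n. moebius d) * of_nat n powr (- s)"
      by (simp add: sum_distrib_right)
    also have "\<dots> = (if n = 1 then 1 else 0)"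
      using n by (subst sum_moebius_divisors) auto
    finally show "(\<Sum>d | d dvd n. ?a d * of_nat (n div d) powr (- s)) = (if n = 1 then 1 else 0)" .
  qed
  finally have 1: "((\<lambda>n::nat. if n = 1 then 1 else 0) has_sum m * (reg_zeta s / (s - 1))) {1..}" .
  have "((\<lambda>n::nat. if n = 1 then 1 else 0 :: complex) has_sum 1) {1..}"
    by (rule has_sum_finite_neutralI[of "{1}"]) auto
  from has_sum_unique[OF 1 this] have "m * reg_zeta s = s - 1"
    using s by (auto simp: field_simps)
  moreover have "s \<noteq> 1" using s by auto
  ultimately show nz: "reg_zeta s \<noteq> 0" by auto
  have "m = (s - 1) / reg_zeta s"
    using \<open>m * reg_zeta s = s - 1\<close> nz by (simp add: nonzero_eq_divide_eq)
  with m show "(?a has_sum ((s - 1) / reg_zeta s)) {1..}" by (simp only:)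
qed

section \<open>Nonvanishing on the line \<open>Re s = 1\<close>\<close>

text \<open>The logarithm of |1 - r u| is minus the sum of r^n Re(u^n) / n. If c is the real part of
  w^n, the weights 3, 4, 1 on the powers of 1, w and w^2 combine to 3 + 4 c + (2 c^2 - 1) = 2 (1 +
  c)^2, which is nonnegative.\<close>

lemma mertens_341:
  fixes r :: real and w :: complex
  assumes "0 \<le> r" "r < 1" "norm w = 1"
  shows "norm ((1 - of_real r) ^ 3 * (1 - of_real r * w) ^ 4 * (1 - of_real r * w ^ 2)) \<le> 1"
proof -
  \<comment> \<open>The logarithm series is indexed from 0; its term there is 0 because division by
    zero yields 0.\<close>
  have ser: "(\<lambda>n. - (r ^ n * Re (u ^ n)) / real n) sums ln (norm (1 - of_real r * u))"
    if u: "norm u = 1" for u :: complex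
  proof -
    have "norm (- (of_real r * u)) < 1" using u assms by (simp add: norm_mult)
    from sums_Re[OF Ln_series'[OF this]]
    have "(\<lambda>n. - (r ^ n * Re (u ^ n)) / real n) sums Re (ln (1 - of_real r * u))"
      by (simp add: power_mult_distrib flip: of_real_power)
    moreover have "1 - of_real r * u \<noteq> 0"
      using u assms by (metis abs_of_nonneg eq_iff_diff_eq_0 less_irrefl mult.right_neutral norm_mult norm_of_real norm_one)
    ultimately show ?thesis by (simp add: Re_Ln)
  qed
  have nz: "1 - of_real r * u \<noteq> 0" if "norm u = 1" for u :: complex
    using that assms by (metis abs_of_nonneg eq_iff_diff_eq_0 less_irrefl mult.right_neutral norm_mult norm_of_real norm_one)
  define L where "L = 3 * ln (norm (1 - of_real r * (1 :: complex))) + 4 * ln (norm (1 - of_real r * w))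
      + ln (norm (1 - of_real r * w ^ 2))"
  have "(\<lambda>n. 3 * (- (r ^ n * Re ((1 :: complex) ^ n)) / real n) + 4 * (- (r ^ n * Re (w ^ n)) / real n)
          + - (r ^ n * Re ((w ^ 2) ^ n)) / real n) sums L"
    unfolding L_def using assms by (intro sums_add sums_mult ser) (auto simp: norm_power)
  moreover have "3 * (- (r ^ n * Re ((1 :: complex) ^ n)) / real n) + 4 * (- (r ^ n * Re (w ^ n)) / real n)
          + - (r ^ n * Re ((w ^ 2) ^ n)) / real n \<le> 0" for n
  proof -
    define x where "x = w ^ n"
    have "norm x = 1" using assms by (simp add: x_def norm_power)
    hence "(Re x)\<^sup>2 + (Im x)\<^sup>2 = 1" by (simp add: cmod_def)
    hence "Re (x ^ 2) = 2 * (Re x)\<^sup>2 - 1" by (simp add: power2_eq_square)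
    moreover have "(w ^ 2) ^ n = x ^ 2" by (simp add: x_def mult.commute flip: power_mult)
    ultimately have e: "Re ((w ^ 2) ^ n) = 2 * (Re x)\<^sup>2 - 1" by (simp only:)
    have "3 * (- (r ^ n * Re ((1 :: complex) ^ n)) / real n) + 4 * (- (r ^ n * Re (w ^ n)) / real n)
          + - (r ^ n * Re ((w ^ 2) ^ n)) / real n = - (r ^ n * (2 * (1 + Re x)\<^sup>2) / real n)"
      unfolding e x_def[symmetric] by (cases "n = 0") (simp_all add: field_simps power2_eq_square)
    also have "\<dots> \<le> 0" using assms by simp
    finally show ?thesis .
  qed
  ultimately have "L \<le> 0"
    by (metis (no_types, lifting) sums_le sums_zero)
  hence "exp L \<le> 1" by simp
  also have "exp L = norm (1 - of_real r * (1 :: complex)) ^ 3 * norm (1 - of_real r * w) ^ 4 * norm (1 - of_real r * w ^ 2)"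
    unfolding L_def exp_add using nz[of 1] nz[of w] nz[of "w ^ 2"] assms
    by (simp add: exp_of_nat_mult[of 3, simplified] exp_of_nat_mult[of 4, simplified] norm_power)
  finally show ?thesis by (simp add: norm_mult norm_power)
qed

text \<open>Sieving \<open>\<zeta>\<close> by one prime at a time gives the Euler product without rearranging an infinite product.\<close>

lemma zeta_sieve_has_sum:
  assumes s: "Re s > 1" and "finite P" "\<And>p. p \<in> P \<Longrightarrow> prime p"
  shows "((\<lambda>n. of_nat n powr (- s)) has_sum (reg_zeta s / (s - 1) * (\<Prod>p\<in>P. 1 - of_nat p powr (- s))))
           {n \<in> {1..}. \<forall>p\<in>P. \<not> p dvd n}"
  using assms(2,3)
proof (induction P)
  case empty
  have "{n::nat. n \<in> {1..} \<and> (\<forall>p\<in>{}. \<not> p dvd n)} = {1..}" by auto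
  thus ?case using zeta_has_sum[OF s] by (simp only: prod.empty mult_1_right)
next
  case (insert p P)
  let ?f = "\<lambda>n. of_nat n powr (- s)"
  let ?C = "{n \<in> {1..}. \<forall>q\<in>P. \<not> q dvd n}"
  let ?S = "reg_zeta s / (s - 1) * (\<Prod>p\<in>P. 1 - of_nat p powr (- s))"
  have p: "prime p" and P: "\<And>q. q \<in> P \<Longrightarrow> prime q" using insert.prems by auto
  have IH: "(?f has_sum ?S) ?C" using insert.IH P by simp
  have "((\<lambda>n. ?f p * ?f n) has_sum ?f p * ?S) ?C"
    by (rule has_sum_cmult_right[OF IH])
  hence "((?f \<circ> (\<lambda>n. p * n)) has_sum ?f p * ?S) ?C"
    by (simp only: o_def of_nat_mult_powr)
  moreover have "inj_on (\<lambda>n. p * n) ?C"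
    using p by (auto simp: inj_on_def prime_gt_0_nat)
  ultimately have "(?f has_sum ?f p * ?S) ((\<lambda>n. p * n) ` ?C)"
    by (simp add: has_sum_reindex)
  also have "(\<lambda>n. p * n) ` ?C = {n \<in> ?C. p dvd n}"
  proof (intro equalityI subsetI)
    fix k assume "k \<in> (\<lambda>n. p * n) ` ?C"
    then obtain n where n: "k = p * n" "n \<in> {1..}" "\<forall>q\<in>P. \<not> q dvd n" by auto
    have "\<not> q dvd p * n" if "q \<in> P" for q
    proof
      assume "q dvd p * n"
      hence "q dvd p" using n P that prime_dvd_multD by blast
      hence "q = p" using P[OF that] p by (simp add: primes_dvd_imp_eq)
      thus False using insert.hyps that by simp
    qed
    thus "k \<in> {n \<in> ?C. p dvd n}"
      using n p prime_gt_0_nat[of p] by (simp add: Suc_le_eq)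
  next
    fix n assume n: "n \<in> {n \<in> ?C. p dvd n}"
    then obtain m where m: "n = p * m" by auto
    hence "m \<in> ?C" using n by (auto intro: Nat.gr0I simp: Suc_le_eq)
    thus "n \<in> (\<lambda>n. p * n) ` ?C" using m by auto
  qed
  finally have "(?f has_sum ?S - ?f p * ?S) (?C - {n \<in> ?C. p dvd n})"
    by (intro has_sum_Diff IH) auto
  moreover have "?C - {n \<in> ?C. p dvd n} = {n \<in> {1..}. \<forall>q\<in>insert p P. \<not> q dvd n}" by auto
  ultimately show ?case using insert.hyps by (simp add: algebra_simps)
qed

text \<open>Sieving by all primes up to N leaves only 1 and integers above N, so the distance to 1
  is at most a tail of the absolutely convergent series.\<close>

lemma euler_product_zeta:
  assumes s: "Re s > 1"
  shows "(\<lambda>N. reg_zeta s / (s - 1) * (\<Prod>p | prime p \<and> p \<le> N. 1 - of_nat p powr (- s))) \<longlonglongrightarrow> 1"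
proof -
  let ?f = "\<lambda>n. of_nat n powr (- s)"
  let ?S = "\<lambda>N. reg_zeta s / (s - 1) * (\<Prod>p | prime p \<and> p \<le> N. 1 - of_nat p powr (- s))"
  obtain T where T: "((\<lambda>n. norm (?f n)) has_sum T) {1..}"
    using norm_powr_summable_on[OF s] by (auto simp: summable_on_def)
  have "(\<lambda>n. norm (?f (Suc n))) sums T"
    using T unfolding has_sum_from_1_iff by (rule has_sum_imp_sums)
  hence "(\<lambda>N. \<Sum>n<N. norm (?f (Suc n))) \<longlonglongrightarrow> T" by (simp add: sums_def)
  hence lim: "(\<lambda>N. T - (\<Sum>n<N. norm (?f (Suc n)))) \<longlonglongrightarrow> 0"
    using tendsto_diff[OF tendsto_const, of _ T sequentially T] by simp
  have "norm (?S N - 1) \<le> T - (\<Sum>n<N. norm (?f (Suc n)))" for N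
  proof -
    let ?C = "{n \<in> {1..}. \<forall>p\<in>{p. prime p \<and> p \<le> N}. \<not> p dvd n}"
    have "(?f has_sum ?S N) ?C"
      by (rule zeta_sieve_has_sum[OF s]) auto
    moreover have "(?f has_sum 1) {1}"
      by (rule has_sum_finiteI) auto
    ultimately have 1: "(?f has_sum ?S N - 1) (?C - {1})"
      by (rule has_sum_Diff) (auto dest: prime_gt_1_nat)
    have "((\<lambda>n. norm (?f n)) has_sum (\<Sum>n\<in>{1..N}. norm (?f n))) {1..N}"
      by (rule has_sum_finite) auto
    hence 2: "((\<lambda>n. norm (?f n)) has_sum T - (\<Sum>n\<in>{1..N}. norm (?f n))) ({1..} - {1..N})"
      by (intro has_sum_Diff[OF T]) auto
    have sub: "?C - {1} \<subseteq> {1..} - {1..N}"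
    proof
      fix n assume n: "n \<in> ?C - {1}"
      then obtain p where p: "prime p" "p dvd n" using prime_factor_nat[of n] by auto
      have "n > N"
      proof (rule ccontr)
        assume "\<not> n > N"
        hence "p \<le> N" using p n dvd_imp_le[of p n] by auto
        thus False using n p by auto
      qed
      thus "n \<in> {1..} - {1..N}" using n by auto
    qed
    have "(\<lambda>n. norm (?f n)) summable_on (?C - {1})"
      by (rule summable_on_subset_banach[OF _ sub]) (use 2 in \<open>auto simp: summable_on_def\<close>)
    then obtain U where U: "((\<lambda>n. norm (?f n)) has_sum U) (?C - {1})"
      by (auto simp: summable_on_def)
    have "norm (?S N - 1) \<le> U"
      by (rule norm_has_sum_bound[OF U 1])
    also have "U \<le> T - (\<Sum>n\<in>{1..N}. norm (?f n))"
      by (rule has_sum_mono_neutral[OF U 2]) (use sub in auto)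
    also have "(\<Sum>n\<in>{1..N}. norm (?f n)) = (\<Sum>n<N. norm (?f (Suc n)))"
      by (rule sum.reindex_bij_witness[of _ Suc "\<lambda>n. n - 1"]) auto
    finally show ?thesis .
  qed
  hence "(\<lambda>N. ?S N - 1) \<longlonglongrightarrow> 0"
    by (intro Lim_null_comparison[OF always_eventually lim]) auto
  thus ?thesis by (simp add: LIM_zero_iff)
qed

text \<open>Multiplied by the finite products over p \<le> N, the expression tends to 1. With r =
  p^(-\<sigma>) and w = p^(-it), \<open>mertens_341\<close> shows that each prime can only decrease
  the norm, so the expression itself has norm at least the limit.\<close>

lemma zeta_341:
  assumes \<sigma>: "\<sigma> > 1"
  defines "Z \<equiv> (\<lambda>s. reg_zeta s / (s - 1))"
  shows "1 \<le> norm (Z (of_real \<sigma>) ^ 3 * Z (Complex \<sigma> t) ^ 4 * Z (Complex \<sigma> (2 * t)))"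
proof -
  let ?P = "\<lambda>s N. (\<Prod>p | prime p \<and> p \<le> N. 1 - of_nat p powr (- s) :: complex)"
  have "(\<lambda>N. norm ((Z (of_real \<sigma>) * ?P (of_real \<sigma>) N) ^ 3 * (Z (Complex \<sigma> t) * ?P (Complex \<sigma> t) N) ^ 4
          * (Z (Complex \<sigma> (2 * t)) * ?P (Complex \<sigma> (2 * t)) N))) \<longlonglongrightarrow> norm (1 ^ 3 * 1 ^ 4 * 1 :: complex)"
    unfolding Z_def using \<sigma> by (intro tendsto_intros euler_product_zeta) auto
  moreover have "norm ((Z (of_real \<sigma>) * ?P (of_real \<sigma>) N) ^ 3 * (Z (Complex \<sigma> t) * ?P (Complex \<sigma> t) N) ^ 4
          * (Z (Complex \<sigma> (2 * t)) * ?P (Complex \<sigma> (2 * t)) N)) \<le>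
       norm (Z (of_real \<sigma>) ^ 3 * Z (Complex \<sigma> t) ^ 4 * Z (Complex \<sigma> (2 * t)))" for N
  proof -
    let ?A = "Z (of_real \<sigma>) ^ 3 * Z (Complex \<sigma> t) ^ 4 * Z (Complex \<sigma> (2 * t))"
    let ?B = "\<Prod>p | prime p \<and> p \<le> N. (1 - of_nat p powr (- of_real \<sigma>)) ^ 3 * (1 - of_nat p powr (- Complex \<sigma> t)) ^ 4
        * (1 - of_nat p powr (- Complex \<sigma> (2 * t)))"
    have "norm ?B \<le> (\<Prod>p | prime p \<and> p \<le> N. 1)"
      unfolding prod_norm[symmetric]
    proof (intro prod_mono conjI norm_ge_zero)
      fix p assume "p \<in> {p. prime p \<and> p \<le> N}"
      hence p: "p > 1" using prime_gt_1_nat by auto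
      define r where "r = real p powr (- \<sigma>)"
      define w where "w = of_nat p powr (- (\<i> * t))"
      have r: "0 \<le> r" "r < 1" using p \<sigma> by (auto simp: r_def powr_less_one)
      have w: "norm w = 1" using p by (simp add: w_def norm_powr_real_powr)
      have r': "of_nat p powr (- of_real \<sigma>) = complex_of_real r"
        using p by (simp add: r_def powr_of_real[symmetric])
      have e1: "- Complex \<sigma> t = - of_real \<sigma> + - (\<i> * t)"
        and e2: "- Complex \<sigma> (2 * t) = - of_real \<sigma> + (- (\<i> * t) + - (\<i> * t))"
        by (simp_all add: complex_eq_iff)
      have c1: "of_nat p powr (- Complex \<sigma> t) = of_real r * w"
        and c2: "of_nat p powr (- Complex \<sigma> (2 * t)) = of_real r * w ^ 2"
        unfolding e1 e2 powr_add r' w_def[symmetric] by (simp_all add: power2_eq_square)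
      show "norm ((1 - of_nat p powr (- of_real \<sigma>)) ^ 3 * (1 - of_nat p powr (- Complex \<sigma> t)) ^ 4
        * (1 - of_nat p powr (- Complex \<sigma> (2 * t)))) \<le> 1"
        unfolding r' c1 c2 by (rule mertens_341[OF r w])
    qed
    hence "norm ?A * norm ?B \<le> norm ?A * 1" by (intro mult_left_mono) auto
    moreover have "?A * ?B = (Z (of_real \<sigma>) * ?P (of_real \<sigma>) N) ^ 3 * (Z (Complex \<sigma> t) * ?P (Complex \<sigma> t) N) ^ 4
          * (Z (Complex \<sigma> (2 * t)) * ?P (Complex \<sigma> (2 * t)) N)"
      by (simp add: prod.distrib prod_power_distrib power_mult_distrib mult_ac)
    ultimately show ?thesis by (simp only: mult_1_right flip: norm_mult)
  qed
  ultimately show ?thesis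
    by (intro LIMSEQ_le_const2[of _ "norm (1 ^ 3 * 1 ^ 4 * 1 :: complex)", simplified]) auto
qed

text \<open>At distance x to the right of the line, a zero at 1 + it would make the fourth power in
  \<open>zeta_341\<close> of order x^4. This beats the x^(-3) coming from the pole at 1, while the
  factor at height 2t stays bounded, so a quantity that is at least 1 would tend to 0.\<close>

lemma reg_zeta_nonzero_Re_eq_1: "reg_zeta (Complex 1 t) \<noteq> 0"
proof (cases "t = 0")
  case True
  hence "Complex 1 t = 1" by (simp add: complex_eq_iff)
  thus ?thesis by simp
next
  case t: False
  show ?thesis
  proof
    assume zero: "reg_zeta (Complex 1 t) = 0"
    have deriv: "(reg_zeta has_field_derivative deriv reg_zeta s) (at s)" if "Re s > 0" for s
      using that by (intro holomorphic_derivI[OF reg_zeta_holomorphic]) (auto simp: open_halfspace_Re_gt)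
    have cont: "((\<lambda>x. reg_zeta (Complex (1 + x) u)) \<longlongrightarrow> reg_zeta (Complex 1 u)) (at_right 0)" for u
    proof -
      have "isCont reg_zeta (Complex 1 u)" using DERIV_isCont[OF deriv] by simp
      moreover have "((\<lambda>x. Complex (1 + x) u) \<longlongrightarrow> Complex (1 + 0) u) (at_right 0)"
        by (intro tendsto_intros)
      ultimately show ?thesis using isCont_tendsto_compose by fastforce
    qed
    have quot: "((\<lambda>x. reg_zeta (Complex (1 + x) t) / of_real x) \<longlongrightarrow> deriv reg_zeta (Complex 1 t)) (at_right 0)"
    proof -
      have "((\<lambda>h. (reg_zeta (Complex 1 t + h) - reg_zeta (Complex 1 t)) / h) \<longlongrightarrow> deriv reg_zeta (Complex 1 t)) (at 0)"
        using deriv[of "Complex 1 t"] by (simp add: DERIV_def)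
      moreover have "filterlim complex_of_real (at 0) (at_right 0)"
        unfolding filterlim_at
        by (auto intro!: tendsto_eq_intros simp: eventually_at_filter)
      ultimately have "((\<lambda>x. (reg_zeta (Complex 1 t + of_real x) - reg_zeta (Complex 1 t)) / of_real x)
          \<longlongrightarrow> deriv reg_zeta (Complex 1 t)) (at_right 0)"
        by (rule filterlim_compose)
      moreover have "Complex 1 t + of_real x = Complex (1 + x) t" for x
        by (simp add: complex_eq_iff)
      ultimately show ?thesis using zero by simp
    qed
    \<comment> \<open>The denominators s - 1 have norm x at height 0, at least \<bar>t\<bar> at
      height t and at least 2 \<bar>t\<bar> at height 2t. Writing x^(-3) as x * x^(-4) turns the
      fourth power into difference quotients at the supposed zero and leaves one factor x.\<close>
    let ?R = "\<lambda>x. x * (norm (reg_zeta (Complex (1 + x) 0)) ^ 3 * norm (reg_zeta (Complex (1 + x) t) / of_real x) ^ 4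
            * norm (reg_zeta (Complex (1 + x) (2 * t))) / (2 * \<bar>t\<bar> ^ 5))"
    have "(?R \<longlongrightarrow> 0 * (norm (reg_zeta (Complex 1 0)) ^ 3 * norm (deriv reg_zeta (Complex 1 t)) ^ 4
            * norm (reg_zeta (Complex 1 (2 * t))) / (2 * \<bar>t\<bar> ^ 5))) (at_right 0)"
      by (intro tendsto_intros cont quot) (use t in auto)
    hence lim: "(?R \<longlongrightarrow> 0) (at_right 0)" by simp
    have "1 \<le> ?R x" if x: "x > 0" for x
    proof -
      have e0: "of_real (1 + x) = Complex (1 + x) 0" by (simp add: complex_eq_iff)
      have n0: "norm (Complex (1 + x) 0 - 1) = x"
        using x by (simp add: cmod_def)
      have n1: "norm (Complex (1 + x) u - 1) \<ge> \<bar>u\<bar>" for u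
        using abs_Im_le_cmod[of "Complex (1 + x) u - 1"] by simp
      define a where "a = norm (reg_zeta (Complex (1 + x) 0))"
      define b where "b = norm (reg_zeta (Complex (1 + x) t))"
      define d where "d = norm (reg_zeta (Complex (1 + x) (2 * t)))"
      have "1 \<le> (a / x) ^ 3 * (b / norm (Complex (1 + x) t - 1)) ^ 4 * (d / norm (Complex (1 + x) (2 * t) - 1))"
        using zeta_341[of "1 + x" t] x unfolding e0 norm_mult norm_power norm_divide n0 a_def b_def d_def
        by simp
      also have "\<dots> \<le> (a / x) ^ 3 * (b / \<bar>t\<bar>) ^ 4 * (d / \<bar>2 * t\<bar>)"
        using n1[of t] n1[of "2 * t"] t x
        by (intro mult_mono power_mono divide_left_mono mult_pos_pos) (auto simp: a_def b_def d_def intro: less_le_trans[of 0 "\<bar>t\<bar>"] less_le_trans[of 0 "2 * \<bar>t\<bar>"] simp: abs_mult)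
      also have "\<dots> = ?R x"
        unfolding a_def[symmetric] d_def[symmetric] norm_divide b_def[symmetric] using x t
        by (simp add: field_simps abs_mult eval_nat_numeral)
      finally show ?thesis .
    qed
    hence "eventually (\<lambda>x. 1 \<le> ?R x) (at_right 0)"
      by (intro eventually_at_right_less[THEN eventually_mono]) auto
    from tendsto_lowerbound[OF lim this] show False by simp
  qed
qed

lemma reg_zeta_nonzero:
  assumes "Re s \<ge> 1"
  shows "reg_zeta s \<noteq> 0"
proof (cases "Re s = 1")
  case True
  thus ?thesis using reg_zeta_nonzero_Re_eq_1[of "Im s"] by (metis complex.collapse)
qed (use assms moebius_has_sum(1)[of s] in auto)

section \<open>Newman's Tauberian theorem\<close>

text \<open>Cauchy's formula with the circle cut into half circles, because the two halves need
  different estimates later. Off 0, H z / z is an entire function plus H 0 / z; the first integrates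
  to 0 over the closed path, the second to \<i> H 0 times the angle of each arc.\<close>

lemma contour_integral_arcs_inverse:
  assumes H: "H holomorphic_on UNIV" and R: "R > 0"
  defines "p \<equiv> part_circlepath 0 R (- (pi / 2)) (pi / 2)"
    and "q \<equiv> part_circlepath 0 R (pi / 2) (3 * pi / 2)"
  shows "contour_integral p (\<lambda>z. H z / z) + contour_integral q (\<lambda>z. H z / z) = 2 * pi * \<i> * H 0"
proof -
  define h where "h = (\<lambda>z. if z = 0 then deriv H 0 else (H z - H 0) / (z - 0))"
  have h: "h holomorphic_on UNIV"
    unfolding h_def by (rule pole_lemma) (use H in auto)
  have hi: "h contour_integrable_on r" if "valid_path r" for r
    by (rule contour_integrable_holomorphic_simple[OF h]) (use that in auto)
  have sub: "path_image p \<subseteq> sphere 0 R" "path_image q \<subseteq> sphere 0 R"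
    unfolding p_def q_def using R by (auto intro!: path_image_part_circlepath_subset')
  have "cis (pi / 2 + pi) = cis (- (pi / 2))"
    by (simp only: complex_eq_iff cis.sel cos_periodic_pi sin_periodic_pi cos_minus sin_minus
          cos_pi_half sin_pi_half) simp
  moreover have "pi / 2 + pi = 3 * pi / 2" by simp
  ultimately have "cis (3 * pi / 2) = cis (- (pi / 2))" by (simp only:)
  hence sf: "pathfinish p = pathstart q" "pathstart p = pathfinish q"
    by (simp_all only: p_def q_def pathstart_part_circlepath pathfinish_part_circlepath cis_conv_exp)
  have "contour_integral (p +++ q) h = 0"
    by (intro contour_integral_unique Cauchy_theorem_convex_simple[OF h])
       (use sf in \<open>auto simp: p_def q_def intro!: valid_path_join\<close>)
  hence h0: "contour_integral p h + contour_integral q h = 0"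
    using sf hi by (subst (asm) contour_integral_join) (auto simp: p_def q_def)
  have inv: "((\<lambda>z. H 0 / z) has_contour_integral H 0 * (\<i> * (t - s))) (part_circlepath 0 R s t)" for s t
  proof -
    have "((\<lambda>x. H 0 * (\<i> * (t - s))) has_integral (H 0 * (\<i> * (t - s)))) {0..1::real}"
      using has_integral_const_real[of "H 0 * (\<i> * (t - s))" 0 1] by simp
    moreover have "(\<lambda>x. H 0 / part_circlepath 0 R s t x *
        (\<i> * R * (of_real t - of_real s) * exp (\<i> * linepath s t x))) = (\<lambda>x. H 0 * (\<i> * (t - s)))"
      using R by (auto simp: part_circlepath_def)
    ultimately show ?thesis
      unfolding has_contour_integral vector_derivative_part_circlepath by simp
  qed
  have *: "contour_integral r (\<lambda>z. H z / z) = contour_integral r h + H 0 * (\<i> * (t - s))"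
    if r: "r = part_circlepath 0 R s t" for r s t
  proof -
    have "contour_integral r (\<lambda>z. H z / z) = contour_integral r (\<lambda>z. h z + H 0 / z)"
      using path_image_part_circlepath_subset'[of R 0 s t] R r
      by (intro contour_integral_cong refl) (auto simp: h_def diff_divide_distrib)
    also have "\<dots> = contour_integral r h + contour_integral r (\<lambda>z. H 0 / z)"
      using hi[of r] inv[where s = s and t = t] r
      by (intro contour_integral_add) (auto simp: contour_integrable_on_def)
    finally show ?thesis
      using contour_integral_unique[OF inv[where s = s and t = t]] r by simp
  qed
  show ?thesis
    using h0 *[OF p_def[THEN meta_eq_to_obj_eq]] *[OF q_def[THEN meta_eq_to_obj_eq]]
    by (simp add: algebra_simps)
qed

text \<open>Integration by parts: the derivative of F z * exp (z T) contains T * F z * exp (z T),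
  and the exponential has norm 1 on the imaginary axis. Staying on the axis, instead of shifting the
  contour to the left of it, gives decay 1 / T without any strip of holomorphy to its left being
  chosen.\<close>

lemma contour_integral_vertical_exp_bound:
  assumes F: "F holomorphic_on \<Omega>" "open \<Omega>" "\<And>z. Re z = 0 \<Longrightarrow> z \<in> \<Omega>"
  obtains C where "\<And>T. T > 0 \<Longrightarrow>
    norm (contour_integral (linepath (\<i> * of_real a) (\<i> * of_real b)) (\<lambda>z. F z * exp (z * of_real T))) \<le> C / T"
proof -
  define l where "l = linepath (\<i> * of_real a) (\<i> * of_real b)"
  have im: "path_image l \<subseteq> \<Omega>" and re0: "\<And>z. z \<in> path_image l \<Longrightarrow> Re z = 0"
  proof -
    show "Re z = 0" if "z \<in> path_image l" for z
      using that by (auto simp: l_def closed_segment_def)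
    thus "path_image l \<subseteq> \<Omega>" using F(3) by auto
  qed
  have F': "deriv F holomorphic_on \<Omega>"
    by (rule holomorphic_deriv) (use F in auto)
  have "compact (deriv F ` path_image l)"
    by (intro compact_continuous_image continuous_on_subset[OF holomorphic_on_imp_continuous_on[OF F'] im])
       (auto simp: l_def)
  then obtain D where D: "D > 0" "\<And>z. z \<in> path_image l \<Longrightarrow> norm (deriv F z) \<le> D"
    using compact_imp_bounded bounded_pos by (metis imageI)
  define P where "P = norm (F (\<i> * b)) + norm (F (\<i> * a))"
  define C where "C = P + D * norm (\<i> * of_real b - \<i> * of_real a)"
  show thesis
  proof
    fix T :: real assume T: "T > 0"
    let ?e = "\<lambda>z. exp (z * of_real T)"
    have e1: "norm (?e z) = 1" if "Re z = 0" for z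
      using that by simp
    have int1: "(\<lambda>z. F z * ?e z) contour_integrable_on l" "(\<lambda>z. deriv F z * ?e z) contour_integrable_on l"
      using F F' im by (auto intro!: contour_integrable_holomorphic_simple[of _ \<Omega>] holomorphic_intros simp: l_def)
    have "((\<lambda>z. deriv F z * ?e z + of_real T * (F z * ?e z)) has_contour_integral
             F (pathfinish l) * ?e (pathfinish l) - F (pathstart l) * ?e (pathstart l)) l"
    proof (rule contour_integral_primitive[of \<Omega>])
      fix z assume z: "z \<in> \<Omega>"
      have "(F has_field_derivative deriv F z) (at z within \<Omega>)"
        using holomorphic_derivI[OF F(1,2) z] by (rule has_field_derivative_at_within)
      thus "((\<lambda>z. F z * ?e z) has_field_derivative deriv F z * ?e z + of_real T * (F z * ?e z)) (at z within \<Omega>)"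
        by (auto intro!: derivative_eq_intros simp: algebra_simps)
    qed (use im in \<open>auto simp: l_def\<close>)
    hence "F (\<i> * b) * ?e (\<i> * b) - F (\<i> * a) * ?e (\<i> * a) =
        contour_integral l (\<lambda>z. deriv F z * ?e z + of_real T * (F z * ?e z))"
      by (simp add: contour_integral_unique l_def)
    also have "\<dots> = contour_integral l (\<lambda>z. deriv F z * ?e z) + T * contour_integral l (\<lambda>z. F z * ?e z)"
      using contour_integral_add[OF int1(2) contour_integrable_lmul[OF int1(1), of "of_real T"]]
        contour_integral_lmul[OF int1(1), of "of_real T"] by (simp only:)
    finally have "T * contour_integral l (\<lambda>z. F z * ?e z) =
        (F (\<i> * b) * ?e (\<i> * b) - F (\<i> * a) * ?e (\<i> * a)) - contour_integral l (\<lambda>z. deriv F z * ?e z)"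
      by (simp only: eq_diff_eq add.commute)
    hence "norm (T * contour_integral l (\<lambda>z. F z * ?e z)) \<le>
        norm (F (\<i> * b) * ?e (\<i> * b) - F (\<i> * a) * ?e (\<i> * a)) + norm (contour_integral l (\<lambda>z. deriv F z * ?e z))"
      by (simp only: norm_triangle_ineq4)
    also have "\<dots> \<le> P + D * norm (\<i> * of_real b - \<i> * of_real a)"
    proof (rule add_mono)
      show "norm (F (\<i> * b) * ?e (\<i> * b) - F (\<i> * a) * ?e (\<i> * a)) \<le> P"
        unfolding P_def by (rule order.trans[OF norm_triangle_ineq4]) (simp add: norm_mult e1)
      show "norm (contour_integral l (\<lambda>z. deriv F z * ?e z)) \<le> D * norm (\<i> * of_real b - \<i> * of_real a)"
        unfolding l_def using int1(2) D re0
        by (intro contour_integral_bound_linepath) (auto simp: l_def norm_mult e1)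
    qed
    finally show "norm (contour_integral (linepath (\<i> * of_real a) (\<i> * of_real b)) (\<lambda>z. F z * ?e z)) \<le> C / T"
      using T by (simp add: C_def l_def norm_mult field_simps)
  qed
qed

text \<open>
  On the circle \<open>R\<^sup>2 = z cnj z\<close>, so Newman's factor \<open>1 + z\<^sup>2/R\<^sup>2\<close> turns \<open>1/z\<close> into \<open>2 Re z / R\<^sup>2\<close>, which
  cancels the \<open>1 / Re z\<close> in the bounds on the transform.
\<close>

lemma newman_kernel_on_circle:
  assumes "norm z = R" "R > 0"
  shows "exp (z * of_real T) * (1 + (z / of_real R)\<^sup>2) / z = exp (z * of_real T) * of_real (2 * Re z / R\<^sup>2)"
proof -
  have "(of_real R)\<^sup>2 = z * cnj z"
    using complex_norm_square[of z] assms by simp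
  hence "(of_real R)\<^sup>2 + z\<^sup>2 = z * (z + cnj z)"
    by (simp add: power2_eq_square algebra_simps)
  hence "(of_real R)\<^sup>2 + z\<^sup>2 = z * of_real (2 * Re z)"
    by (simp add: complex_add_cnj)
  moreover have "z \<noteq> 0" using assms by auto
  ultimately show ?thesis using assms
    by (simp add: field_simps power2_eq_square)
qed

text \<open>Cauchy's formula with Newman's kernel on a circle of radius R expresses G T 0 - g 0 by
  four arc integrals. Those of G T - g on the right and of G T on the left are O(B / R) by the two
  hypotheses. Those of g - g 0 on the right and of the constant g 0 on the left are O(1 / T) for
  fixed R. Using only the constant on the left arc avoids values of g where it may not
  extend.\<close>

lemma newman_analytic:
  fixes G :: "real \<Rightarrow> complex \<Rightarrow> complex" and g :: "complex \<Rightarrow> complex"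
  assumes G: "\<And>T. T > 0 \<Longrightarrow> G T holomorphic_on UNIV"
    and g: "g holomorphic_on \<Omega>" "open \<Omega>" "{z. Re z \<ge> 0} \<subseteq> \<Omega>"
    and left: "\<And>T z. T > 0 \<Longrightarrow> Re z < 0 \<Longrightarrow> norm (G T z) \<le> B * exp (- T * Re z) / (- Re z)"
    and right: "\<And>T z. T > 0 \<Longrightarrow> Re z > 0 \<Longrightarrow> norm (G T z - g z) \<le> B * exp (- T * Re z) / Re z"
  shows "((\<lambda>T. G T 0) \<longlongrightarrow> g 0) at_top"
proof -
  have B: "B \<ge> 0"
    using order.trans[OF norm_ge_zero left[of 1 "-1"]] by (simp add: zero_le_mult_iff)
  \<comment> \<open>Subtracting g 0 removes the pole of the kernel at 0, so that the right arc can
    be moved onto the diameter, which passes through 0.\<close>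
  define h where "h = (\<lambda>z. if z = 0 then deriv g 0 else (g z - g 0) / (z - 0))"
  have h: "h holomorphic_on \<Omega>"
    unfolding h_def by (rule pole_lemma) (use g in \<open>auto simp: interior_open\<close>)
  have bound: "\<exists>D. \<forall>T>0. norm (G T 0 - g 0) \<le> 2 * B / R + D / T" if R: "R > 0" for R
  proof -
    define p where "p = part_circlepath 0 R (- (pi / 2)) (pi / 2)"
    define q where "q = part_circlepath 0 R (pi / 2) (3 * pi / 2)"
    define l where "l = linepath (\<i> * of_real R) (\<i> * of_real (- R))"
    define W where "W = (\<lambda>z::complex. 1 + (z / of_real R)\<^sup>2)"
    define F where "F = (\<lambda>z. h z * W z)"
    have W: "W holomorphic_on A" for A
      unfolding W_def using R by (intro holomorphic_intros) auto
    have F: "F holomorphic_on \<Omega>" unfolding F_def by (intro holomorphic_intros h W)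
    obtain C where C: "\<And>T. T > 0 \<Longrightarrow> norm (contour_integral l (\<lambda>z. F z * exp (z * of_real T))) \<le> C / T"
      unfolding l_def
    proof (rule contour_integral_vertical_exp_bound[OF F g(2), where a = R and b = "- R"])
      show "z \<in> \<Omega>" if "Re z = 0" for z using that g(3) by auto
    qed blast
    have sphere: "norm z = R" if "z \<in> path_image p \<union> path_image q" for z
      using that path_image_part_circlepath_subset'[of R 0] R by (fastforce simp: p_def q_def)
    have rep: "Re z \<ge> 0" if "z \<in> path_image p" for z
      using that R by (auto simp: p_def path_image_part_circlepath' closed_segment_eq_real_ivl
          intro!: mult_nonneg_nonneg cos_ge_zero)
    have req: "Re z \<le> 0" if "z \<in> path_image q" for z
    proof -
      have "z \<in> (\<lambda>x. R * cis x) ` {pi / 2..3 * pi / 2}"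
        using that by (simp add: q_def path_image_part_circlepath' closed_segment_eq_real_ivl)
      then obtain x where "x \<in> {pi / 2..3 * pi / 2}" "z = R * cis x" by (rule imageE) simp
      hence x: "pi / 2 \<le> x" "x \<le> 3 * pi / 2" "z = R * cis x" by (simp_all only: atLeastAtMost_iff)
      have "cos (x - pi) \<ge> 0" using x by (intro cos_ge_zero) auto
      thus ?thesis using x(3) R by (simp add: mult_le_0_iff)
    qed
    have nz: "z \<noteq> 0" if "z \<in> path_image p \<union> path_image q" for z using sphere[OF that] R by auto
    have ends: "pathstart p = - (\<i> * of_real R)" "pathfinish p = \<i> * of_real R"
      by (simp_all add: p_def exp_Euler cis_conv_exp[symmetric] complex_eq_iff)
        (simp_all add: exp_eq_polar)
    have vp [simp]: "valid_path p" "valid_path q" "valid_path l"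
      by (simp_all add: p_def q_def l_def)
    have pO: "path_image p \<subseteq> \<Omega>" using rep g(3) by auto
    have lO: "path_image l \<subseteq> {z. Re z \<ge> 0}"
      by (auto simp: l_def closed_segment_def)
    \<comment> \<open>Collects the two contributions of order 1 / T: C from the diameter, the rest
      from the constant g 0 on the left arc of length R * pi. The division by 2 pi is the one in
      Cauchy's formula.\<close>
    define D where "D = (C + norm (g 0) * (2 / R\<^sup>2 * R * pi)) / (2 * pi)"
    have "norm (G T 0 - g 0) \<le> 2 * B / R + D / T" if T: "T > 0" for T
    proof -
      define K where "K = (\<lambda>z. exp (z * of_real T) * W z / z)"
      have K: "K z = exp (z * of_real T) * of_real (2 * Re z / R\<^sup>2)"
        if "z \<in> path_image p \<union> path_image q" for z
        unfolding K_def W_def by (rule newman_kernel_on_circle[OF sphere[OF that] R])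
      have normK: "norm (K z) = exp (T * Re z) * (2 * \<bar>Re z\<bar> / R\<^sup>2)"
        if "z \<in> path_image p \<union> path_image q" for z
        using K[OF that] by (simp add: norm_mult norm_divide mult.commute norm_power)
      have contK: "continuous_on (path_image p) K" "continuous_on (path_image q) K"
        unfolding K_def using nz
        by (auto intro!: continuous_intros holomorphic_on_imp_continuous_on[OF W])
      have contG: "continuous_on A (G T)" for A
        using holomorphic_on_imp_continuous_on[OF G[OF T]] continuous_on_subset by blast
      have contg: "continuous_on (path_image p) g"
        using holomorphic_on_imp_continuous_on[OF g(1)] pO continuous_on_subset by blast
      have intp: "f contour_integrable_on p" if "continuous_on (path_image p) f" for f
        using contour_integrable_continuous_part_circlepath that by (simp add: p_def)
      have intq: "f contour_integrable_on q" if "continuous_on (path_image q) f" for f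
        using contour_integrable_continuous_part_circlepath that by (simp add: q_def)
      have circ: "contour_integral p (\<lambda>z. H z * K z) + contour_integral q (\<lambda>z. H z * K z) = 2 * pi * \<i> * H 0"
        if H: "H holomorphic_on UNIV" for H
      proof -
        have "(\<lambda>z. H z * (exp (z * of_real T) * W z)) holomorphic_on UNIV"
          by (intro holomorphic_intros H W)
        from contour_integral_arcs_inverse[OF this R] show ?thesis
          by (simp add: p_def q_def K_def W_def)
      qed
      have 1: "contour_integral p (\<lambda>z. G T z * K z) + contour_integral q (\<lambda>z. G T z * K z) = 2 * pi * \<i> * G T 0"
        by (rule circ[OF G[OF T]])
      have 2: "contour_integral p (\<lambda>z. g 0 * K z) + contour_integral q (\<lambda>z. g 0 * K z) = 2 * pi * \<i> * g 0"
        by (rule circ) auto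
      have 3: "contour_integral p (\<lambda>z. G T z * K z) =
          contour_integral p (\<lambda>z. (G T z - g z) * K z) + contour_integral p (\<lambda>z. (g z - g 0) * K z)
            + contour_integral p (\<lambda>z. g 0 * K z)"
      proof -
        have "contour_integral p (\<lambda>z. G T z * K z) =
            contour_integral p (\<lambda>z. ((G T z - g z) * K z + (g z - g 0) * K z) + g 0 * K z)"
          by (simp add: algebra_simps)
        also have "\<dots> = contour_integral p (\<lambda>z. (G T z - g z) * K z + (g z - g 0) * K z) + contour_integral p (\<lambda>z. g 0 * K z)"
          by (intro contour_integral_add intp continuous_intros contK contG contg)
        also have "contour_integral p (\<lambda>z. (G T z - g z) * K z + (g z - g 0) * K z) =
             contour_integral p (\<lambda>z. (G T z - g z) * K z) + contour_integral p (\<lambda>z. (g z - g 0) * K z)"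
          by (intro contour_integral_add intp continuous_intros contK contG contg)
        finally show ?thesis .
      qed
      have 4: "norm (contour_integral p (\<lambda>z. (g z - g 0) * K z)) \<le> C / T"
      proof -
        have "contour_integral p (\<lambda>z. (g z - g 0) * K z) = contour_integral p (\<lambda>z. F z * exp (z * of_real T))"
          using nz by (intro contour_integral_cong refl) (auto simp: F_def K_def h_def)
        moreover have "((\<lambda>z. F z * exp (z * of_real T)) has_contour_integral 0) (p +++ l)"
        proof (rule Cauchy_theorem_convex[where S = "{z. Re z \<ge> 0}" and K = "{}"])
          have *: "(\<lambda>z. F z * exp (z * of_real T)) holomorphic_on \<Omega>"
            by (intro holomorphic_intros F)
          show "continuous_on {z. 0 \<le> Re z} (\<lambda>z. F z * exp (z * of_real T))"
            using holomorphic_on_imp_continuous_on[OF *] g(3) continuous_on_subset by blast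
          show "(\<lambda>z. F z * exp (z * of_real T)) field_differentiable at x"
            if "x \<in> interior {z. 0 \<le> Re z} - {}" for x
            using * g(2,3) that interior_subset
            by (intro holomorphic_on_imp_differentiable_at[OF *]) blast+
          show "path_image (p +++ l) \<subseteq> {z. 0 \<le> Re z}"
            using lO rep path_image_join_subset[of p l] by blast
        qed (use ends in \<open>auto simp: convex_halfspace_Re_ge l_def intro!: valid_path_join\<close>)
        hence "contour_integral (p +++ l) (\<lambda>z. F z * exp (z * of_real T)) = 0"
          by (rule contour_integral_unique)
        hence "contour_integral p (\<lambda>z. F z * exp (z * of_real T)) + contour_integral l (\<lambda>z. F z * exp (z * of_real T)) = 0"
          using lO pO g ends F
          by (subst (asm) contour_integral_join)
             (auto intro!: contour_integrable_holomorphic_simple[of _ \<Omega>] holomorphic_intros simp: l_def)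
        ultimately show ?thesis using C[OF T] by (simp add: add_eq_0_iff)
      qed
      have 5: "norm (contour_integral p (\<lambda>z. (G T z - g z) * K z)) \<le> 2 * B / R\<^sup>2 * R * (pi / 2 - (- (pi / 2)))"
        unfolding p_def
      proof (rule contour_integral_bound_part_circlepath_strong[where k = "{}"]; (fold p_def)?)
        show "(\<lambda>z. (G T z - g z) * K z) contour_integrable_on p"
          by (intro intp continuous_intros contK contG contg)
        fix z assume "z \<in> path_image p - {}"
        hence z: "z \<in> path_image p" by simp
        \<comment> \<open>The hypothesis \<open>right\<close> says nothing on the imaginary axis,
          but there the kernel itself vanishes.\<close>
        show "norm ((G T z - g z) * K z) \<le> 2 * B / R\<^sup>2"
        proof (cases "Re z = 0")
          case False
          hence "Re z > 0" using rep[OF z] by simp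
          have "norm ((G T z - g z) * K z) \<le>
              B * exp (- T * Re z) / Re z * (exp (T * Re z) * (2 * \<bar>Re z\<bar> / R\<^sup>2))"
            using mult_right_mono[OF right[OF T \<open>Re z > 0\<close>] norm_ge_zero[of "K z"]] normK[of z] z
            by (simp add: norm_mult)
          also have "\<dots> = 2 * B / R\<^sup>2"
            using \<open>Re z > 0\<close> by (simp add: exp_minus field_simps)
          finally show ?thesis .
        qed (use normK[of z] z B in \<open>simp add: norm_mult\<close>)
      qed (use B R in auto)
      have 6: "norm (contour_integral q (\<lambda>z. G T z * K z)) \<le> 2 * B / R\<^sup>2 * R * (3 * pi / 2 - pi / 2)"
        unfolding q_def
      proof (rule contour_integral_bound_part_circlepath_strong[where k = "{}"]; (fold q_def)?)
        show "(\<lambda>z. G T z * K z) contour_integrable_on q"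
          by (intro intq continuous_intros contK contG)
        fix z assume "z \<in> path_image q - {}"
        hence z: "z \<in> path_image q" by simp
        show "norm (G T z * K z) \<le> 2 * B / R\<^sup>2"
        proof (cases "Re z = 0")
          case False
          hence "Re z < 0" using req[OF z] by simp
          have "norm (G T z * K z) \<le>
              B * exp (- T * Re z) / (- Re z) * (exp (T * Re z) * (2 * \<bar>Re z\<bar> / R\<^sup>2))"
            using mult_right_mono[OF left[OF T \<open>Re z < 0\<close>] norm_ge_zero[of "K z"]] normK[of z] z
            by (simp add: norm_mult)
          also have "\<dots> = 2 * B / R\<^sup>2"
            using \<open>Re z < 0\<close> by (simp add: exp_minus field_simps)
          finally show ?thesis .
        qed (use normK[of z] z B in \<open>simp add: norm_mult\<close>)
      qed (use B R in auto)
      have 7: "norm (contour_integral q (\<lambda>z. g 0 * K z)) \<le> norm (g 0) * (2 / R\<^sup>2 / T) * R * (3 * pi / 2 - pi / 2)"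
        unfolding q_def
      proof (rule contour_integral_bound_part_circlepath_strong[where k = "{}"]; (fold q_def)?)
        show "(\<lambda>z. g 0 * K z) contour_integrable_on q"
          by (intro intq continuous_intros contK)
        fix z assume "z \<in> path_image q - {}"
        hence z: "z \<in> path_image q" by simp
        \<comment> \<open>Here nothing cancels the growth of Re z, so y \<le> exp y at y = T
          \<bar>Re z\<bar> trades the factor \<bar>Re z\<bar> of the kernel and its exponential
          decay for 1 / T.\<close>
        have "T * \<bar>Re z\<bar> \<le> exp (T * \<bar>Re z\<bar>)"
          using exp_ge_add_one_self[of "T * \<bar>Re z\<bar>"] by linarith
        hence "exp (T * Re z) * (T * \<bar>Re z\<bar>) \<le> exp (T * Re z) * exp (T * \<bar>Re z\<bar>)"
          by (intro mult_left_mono) auto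
        also have "\<dots> = 1" using req[OF z] by (simp flip: exp_add)
        finally have "exp (T * Re z) * (2 * \<bar>Re z\<bar> / R\<^sup>2) \<le> 2 / R\<^sup>2 / T"
          using T R by (simp add: field_simps)
        thus "norm (g 0 * K z) \<le> norm (g 0) * (2 / R\<^sup>2 / T)"
          using normK[of z] z unfolding norm_mult by (intro mult_left_mono) auto
      qed (use T R in auto)
      define X1 where "X1 = contour_integral p (\<lambda>z. (G T z - g z) * K z)"
      define X2 where "X2 = contour_integral p (\<lambda>z. (g z - g 0) * K z)"
      define X3 where "X3 = contour_integral q (\<lambda>z. G T z * K z)"
      define X4 where "X4 = contour_integral q (\<lambda>z. g 0 * K z)"
      have "2 * pi * \<i> * (G T 0 - g 0) = X1 + X2 + X3 - X4"
        unfolding X1_def X2_def X3_def X4_def right_diff_distrib[of "2 * pi * \<i>"]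
          1[symmetric] 2[symmetric] 3 by simp
      hence "norm (2 * pi * \<i> * (G T 0 - g 0)) \<le> norm X1 + norm X2 + norm X3 + norm X4"
        by (metis (no_types, opaque_lifting) add_mono norm_triangle_ineq norm_triangle_ineq4 order.trans order_refl)
      also have "\<dots> \<le> 2 * B / R\<^sup>2 * R * pi + C / T + 2 * B / R\<^sup>2 * R * pi + norm (g 0) * (2 / R\<^sup>2 / T) * R * pi"
        using 4 5 6 7 unfolding X1_def X2_def X3_def X4_def by (intro add_mono) auto
      also have "norm (2 * pi * \<i> * (G T 0 - g 0)) = 2 * pi * norm (G T 0 - g 0)"
        by (simp add: norm_mult)
      finally show ?thesis
        using R T by (simp add: D_def field_simps power2_eq_square)
    qed
    thus ?thesis by blast
  qed
  show ?thesis
  proof (rule tendstoI)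
    fix \<epsilon> :: real assume \<epsilon>: "\<epsilon> > 0"
    \<comment> \<open>Then 2 B / R is below \<epsilon> / 2; the 1 added to B keeps R positive if B =
      0.\<close>
    define R where "R = 4 * (B + 1) / \<epsilon>"
    have R: "R > 0" using B \<epsilon> by (simp add: R_def)
    obtain D where D: "\<And>T. T > 0 \<Longrightarrow> norm (G T 0 - g 0) \<le> 2 * B / R + D / T"
      using bound[OF R] by blast
    have BR: "2 * B / R < \<epsilon> / 2 + \<epsilon> / 2"
      using B \<epsilon> by (auto simp: R_def field_simps intro!: add_pos_nonneg)
    have "((\<lambda>T. 2 * B / R + D / T) \<longlongrightarrow> 2 * B / R + 0) at_top"
      by (intro tendsto_intros tendsto_divide_0[OF tendsto_const] filterlim_at_top_imp_at_infinity filterlim_ident)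
    hence "eventually (\<lambda>T. 2 * B / R + D / T < \<epsilon>) at_top"
      using BR by (intro order_tendstoD(2)) auto
    with eventually_gt_at_top[of 0] show "eventually (\<lambda>T. dist (G T 0) (g 0) < \<epsilon>) at_top"
      by eventually_elim (use D in \<open>force simp: dist_norm\<close>)
  qed
qed

section \<open>Sums of \<open>\<mu>(k)/k\<close>\<close>

definition log_moebius_sum :: "real \<Rightarrow> real" where
  "log_moebius_sum x = (\<Sum>k = 1..nat \<lfloor>x\<rfloor>. real_of_int (moebius k) / real k * ln (x / real k))"

section \<open>The truncated Laplace transform\<close>

definition laplace_moebius :: "real \<Rightarrow> complex \<Rightarrow> complex" where
  "laplace_moebius T z = integral {0..T} (\<lambda>t. of_real (moebius_sum (exp t)) * exp (- (z * of_real t)))"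

lemma exp_has_integral_complex:
  fixes z :: complex
  assumes "a \<le> b" "z \<noteq> 0"
  shows "((\<lambda>t. exp (- (z * of_real t))) has_integral (exp (- (z * of_real a)) - exp (- (z * of_real b))) / z) {a..b}"
proof -
  have "((\<lambda>t. exp (- (z * of_real t))) has_integral
      (- exp (- (z * of_real b)) / z - - exp (- (z * of_real a)) / z)) {a..b}"
    using assms
    by (intro fundamental_theorem_of_calculus has_vector_derivative_real_field)
       (auto intro!: derivative_eq_intros)
  thus ?thesis by (simp add: diff_divide_distrib)
qed

lemma exp_has_integral_real:
  assumes "a \<le> b" "x \<noteq> (0::real)"
  shows "((\<lambda>t. exp (- (x * t))) has_integral (exp (- (x * a)) - exp (- (x * b))) / x) {a..b}"
proof -
  have "((\<lambda>t. exp (- (x * t))) has_integral (- exp (- (x * b)) / x - - exp (- (x * a)) / x)) {a..b}"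
    using assms
    by (intro fundamental_theorem_of_calculus)
       (auto intro!: derivative_eq_intros simp flip: has_real_derivative_iff_has_vector_derivative)
  thus ?thesis by (simp add: diff_divide_distrib)
qed

lemma le_nat_floor_exp_iff:
  assumes "k > 0"
  shows "k \<le> nat \<lfloor>exp t\<rfloor> \<longleftrightarrow> ln (real k) \<le> t"
proof -
  have "k \<le> nat \<lfloor>exp t\<rfloor> \<longleftrightarrow> real k \<le> exp t"
    by (simp add: le_nat_iff le_floor_iff)
  also have "\<dots> \<longleftrightarrow> exp (ln (real k)) \<le> exp t" using assms by simp
  finally show ?thesis by (simp only: exp_le_cancel_iff)
qed

text \<open>The term of index k in \<open>moebius_sum (exp t)\<close> switches on at t = ln k, so
  the step function is a finite sum of indicators of [ln k, T]. In this form holomorphy in z and the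
  value at 0 can be read off.\<close>

lemma laplace_moebius_has_integral:
  fixes z :: complex
  assumes "T \<ge> 0"
  shows "((\<lambda>t. of_real (moebius_sum (exp t)) * exp (- (z * of_real t))) has_integral
     (\<Sum>k = 1..nat \<lfloor>exp T\<rfloor>. of_real (moebius k / real k) * integral {ln (real k)..T} (\<lambda>t. exp (- (z * of_real t))))) {0..T}"
proof -
  let ?N = "nat \<lfloor>exp T\<rfloor>"
  let ?e = "\<lambda>t. exp (- (z * of_real t)) :: complex"
  have "((\<lambda>t. \<Sum>k = 1..?N. of_real (moebius k / real k) * (if t \<in> {ln (real k)..T} then ?e t else 0)) has_integral
     (\<Sum>k = 1..?N. of_real (moebius k / real k) * integral {ln (real k)..T} ?e)) {0..T}"
  proof (intro has_integral_sum has_integral_mult_right)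
    fix k assume k: "k \<in> {1..?N}"
    have "(?e has_integral integral {ln (real k)..T} ?e) {ln (real k)..T}"
      by (intro integrable_integral integrable_continuous_real continuous_intros)
    thus "((\<lambda>t. if t \<in> {ln (real k)..T} then ?e t else 0) has_integral integral {ln (real k)..T} ?e) {0..T}"
      using k by (subst has_integral_restrict) auto
  qed auto
  thus ?thesis
  proof (rule has_integral_eq[rotated])
    fix t assume t: "t \<in> {0..T}"
    have "?N \<ge> nat \<lfloor>exp t\<rfloor>" using t by (intro nat_mono floor_mono) auto
    hence "(\<Sum>k = 1..?N. of_real (moebius k / real k) * (if t \<in> {ln (real k)..T} then ?e t else 0)) =
        (\<Sum>k = 1..nat \<lfloor>exp t\<rfloor>. of_real (moebius k / real k) * ?e t)"
      using t le_nat_floor_exp_iff[of _ t]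
      by (intro sum.mono_neutral_cong_right) auto
    thus "(\<Sum>k = 1..?N. of_real (moebius k / real k) * (if t \<in> {ln (real k)..T} then ?e t else 0)) =
        of_real (moebius_sum (exp t)) * ?e t"
      by (simp add: moebius_sum_def sum_distrib_right)
  qed
qed

lemma laplace_moebius_eq:
  assumes "T \<ge> 0"
  shows "laplace_moebius T z =
    (\<Sum>k = 1..nat \<lfloor>exp T\<rfloor>. of_real (moebius k / real k) * integral {ln (real k)..T} (\<lambda>t. exp (- (z * of_real t))))"
  unfolding laplace_moebius_def by (rule integral_unique[OF laplace_moebius_has_integral[OF assms]])

lemma laplace_moebius_holomorphic:
  assumes "T \<ge> 0"
  shows "laplace_moebius T holomorphic_on UNIV"
proof -
  have "(\<lambda>z. integral (cbox a b) (\<lambda>t. exp (- (z * of_real t)))) holomorphic_on UNIV" for a b :: real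
  proof (rule leibniz_rule_holomorphic[where fx = "\<lambda>z t. exp (- (z * of_real t)) * (- of_real t)"])
    show "continuous_on (UNIV \<times> cbox a b) (\<lambda>(z, t). exp (- (z * complex_of_real t)) * - complex_of_real t)"
      by (auto simp: split_beta intro!: continuous_intros)
    show "((\<lambda>z. exp (- (z * complex_of_real t))) has_field_derivative
        exp (- (z * complex_of_real t)) * (- of_real t)) (at z within UNIV)" for z t
      by (auto intro!: derivative_eq_intros)
  qed (auto intro!: integrable_continuous_real continuous_intros)
  hence "(\<lambda>z. \<Sum>k = 1..nat \<lfloor>exp T\<rfloor>. of_real (moebius k / real k) *
      integral {ln (real k)..T} (\<lambda>t. exp (- (z * of_real t)))) holomorphic_on UNIV"
    by (intro holomorphic_intros) auto
  moreover have "laplace_moebius T = (\<lambda>z. \<Sum>k = 1..nat \<lfloor>exp T\<rfloor>. of_real (moebius k / real k) *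
      integral {ln (real k)..T} (\<lambda>t. exp (- (z * of_real t))))"
    using laplace_moebius_eq[OF assms] by blast
  ultimately show ?thesis by simp
qed

text \<open>The integrand over [T, T'] is at most exp (- Re z * t) because
  \<open>moebius_sum\<close> is bounded by 1. Both growth conditions of Newman's theorem come from
  this: one starts the interval at 0, the other lets T' tend to infinity.\<close>

lemma laplace_moebius_diff_le:
  assumes T: "0 \<le> T" "T \<le> T'" and z: "Re z \<noteq> 0"
  shows "norm (laplace_moebius T' z - laplace_moebius T z) \<le> (exp (- (Re z * T)) - exp (- (Re z * T'))) / Re z"
proof -
  let ?f = "\<lambda>t. of_real (moebius_sum (exp t)) * exp (- (z * of_real t))"
  have int: "?f integrable_on {0..T'}"
    using laplace_moebius_has_integral[of T' z] T by (auto simp: integrable_on_def)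
  have "laplace_moebius T z + integral {T..T'} ?f = laplace_moebius T' z"
    unfolding laplace_moebius_def using T int by (intro Henstock_Kurzweil_Integration.integral_combine) auto
  hence "laplace_moebius T' z - laplace_moebius T z = integral {T..T'} ?f" by (simp add: algebra_simps)
  also have "norm \<dots> \<le> integral {T..T'} (\<lambda>t. exp (- (Re z * t)))"
  proof (rule integral_norm_bound_integral)
    show "?f integrable_on {T..T'}"
      by (rule integrable_on_subinterval[OF int]) (use T in auto)
    show "(\<lambda>t. exp (- (Re z * t))) integrable_on {T..T'}"
      by (intro integrable_continuous_real continuous_intros)
    show "norm (?f t) \<le> exp (- (Re z * t))" for t
      using abs_moebius_sum_le_1[of "exp t"] by (simp add: norm_mult mult_left_le_one_le)
  qed
  also have "\<dots> = (exp (- (Re z * T)) - exp (- (Re z * T'))) / Re z"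
    using exp_has_integral_real[OF T(2) z] by (rule integral_unique)
  finally show ?thesis .
qed

lemma has_sum_imp_tendsto_sum:
  fixes f :: "nat \<Rightarrow> 'a :: real_normed_vector"
  assumes "(f has_sum S) {1..}"
  shows "(\<lambda>N. \<Sum>n = 1..N. f n) \<longlonglongrightarrow> S"
proof -
  have "(\<lambda>n. f (Suc n)) sums S"
    using assms unfolding has_sum_from_1_iff by (rule has_sum_imp_sums)
  moreover have "(\<Sum>n<N. f (Suc n)) = (\<Sum>n = 1..N. f n)" for N
    by (rule sum.reindex_bij_witness[of _ "\<lambda>n. n - 1" Suc]) auto
  ultimately show ?thesis by (simp add: sums_def)
qed

lemma filterlim_nat_floor_exp: "filterlim (\<lambda>T. nat \<lfloor>exp T :: real\<rfloor>) sequentially at_top"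
  by (intro filterlim_compose[OF filterlim_nat_sequentially] filterlim_compose[OF filterlim_floor_sequentially] exp_at_top)

text \<open>Integrating term by term gives the partial Dirichlet series of mu at 1 + z minus
  \<open>moebius_sum (exp T)\<close> * exp (- z T), all divided by z. The subtracted term dies out,
  and the series tends to z / \<open>reg_zeta (1 + z)\<close>, whose z cancels.\<close>

lemma laplace_moebius_tendsto:
  assumes z: "Re z > 0"
  shows "((\<lambda>T. laplace_moebius T z) \<longlongrightarrow> 1 / reg_zeta (1 + z)) at_top"
proof -
  have z0: "z \<noteq> 0" using z by auto
  let ?A = "\<lambda>N. \<Sum>k = 1..N. of_int (moebius k) * of_nat k powr (- (1 + z))"
  have "((\<lambda>n. of_int (moebius n) * of_nat n powr (- (1 + z))) has_sum ((1 + z - 1) / reg_zeta (1 + z))) {1..}"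
    using z by (intro moebius_has_sum) auto
  hence "?A \<longlonglongrightarrow> (1 + z - 1) / reg_zeta (1 + z)" by (rule has_sum_imp_tendsto_sum)
  from filterlim_compose[OF this filterlim_nat_floor_exp]
  have "((\<lambda>T::real. ?A (nat \<lfloor>exp T\<rfloor>)) \<longlongrightarrow> z / reg_zeta (1 + z)) at_top" by simp
  moreover have "((\<lambda>T. of_real (moebius_sum (exp T)) * exp (- (z * of_real T))) \<longlongrightarrow> 0) at_top"
  proof (rule Lim_null_comparison)
    show "eventually (\<lambda>T. norm (of_real (moebius_sum (exp T)) * exp (- (z * of_real T))) \<le> exp (- (Re z * T))) at_top"
      using abs_moebius_sum_le_1 by (auto intro!: always_eventually simp: norm_mult mult_left_le_one_le)
    show "((\<lambda>T. exp (- (Re z * T))) \<longlongrightarrow> 0) at_top"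
      using z by (intro filterlim_compose[OF exp_at_bot] filterlim_compose[OF filterlim_uminus_at_bot_at_top]
            filterlim_tendsto_pos_mult_at_top[OF tendsto_const] filterlim_ident)
  qed
  ultimately have "((\<lambda>T. (?A (nat \<lfloor>exp T\<rfloor>) - of_real (moebius_sum (exp T)) * exp (- (z * of_real T))) / z) \<longlongrightarrow>
      (z / reg_zeta (1 + z) - 0) / z) at_top"
    using z0 by (intro tendsto_intros)
  moreover have "eventually (\<lambda>T. laplace_moebius T z =
      (?A (nat \<lfloor>exp T\<rfloor>) - of_real (moebius_sum (exp T)) * exp (- (z * of_real T))) / z) at_top"
    using eventually_ge_at_top[of 0]
  proof eventually_elim
    case (elim T)
    have "laplace_moebius T z = (\<Sum>k = 1..nat \<lfloor>exp T\<rfloor>.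
        (of_int (moebius k) * of_nat k powr (- (1 + z)) - of_real (moebius k / real k) * exp (- (z * of_real T))) / z)"
      unfolding laplace_moebius_eq[OF elim]
    proof (intro sum.cong refl)
      fix k assume k: "k \<in> {1..nat \<lfloor>exp T\<rfloor>}"
      have "integral {ln (real k)..T} (\<lambda>t. exp (- (z * of_real t))) = (exp (- (z * of_real (ln (real k)))) - exp (- (z * of_real T))) / z"
        by (intro integral_unique exp_has_integral_complex z0) (use k le_nat_floor_exp_iff in auto)
      moreover have "of_nat k powr (- (1 + z)) = exp (- (z * of_real (ln (real k)))) / of_nat k"
      proof -
        have "complex_of_nat k powr (- (1 + z)) = exp (- (1 + z) * ln (of_nat k))"
          using k by (simp add: powr_def)
        also have "ln (of_nat k :: complex) = of_real (ln (real k))"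
          using k by (metis Ln_of_real atLeastAtMost_iff less_le_trans of_nat_0_less_iff of_real_of_nat_eq zero_less_one)
        also have "- (1 + z) * of_real (ln (real k)) = - (z * of_real (ln (real k))) + - of_real (ln (real k))"
          by (simp add: algebra_simps)
        also have "exp \<dots> = exp (- (z * of_real (ln (real k)))) * of_real (exp (- ln (real k)))"
          by (simp only: exp_add exp_of_real flip: of_real_minus)
        finally show ?thesis using k by (simp add: exp_minus divide_inverse)
      qed
      ultimately show "of_real (moebius k / real k) * integral {ln (real k)..T} (\<lambda>t. exp (- (z * of_real t))) =
        (of_int (moebius k) * of_nat k powr (- (1 + z)) - of_real (moebius k / real k) * exp (- (z * of_real T))) / z"
        by (simp only: of_real_divide of_real_of_int_eq of_real_of_nat_eq)
           (simp add: right_diff_distrib diff_divide_distrib)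
    qed
    also have "\<dots> = (?A (nat \<lfloor>exp T\<rfloor>) - of_real (moebius_sum (exp T)) * exp (- (z * of_real T))) / z"
      by (simp add: sum_subtractf moebius_sum_def sum_distrib_right flip: sum_divide_distrib)
    finally show ?case .
  qed
  ultimately show ?thesis
    using z0 by (simp add: tendsto_cong)
qed

lemma laplace_moebius_0:
  assumes "T \<ge> 0"
  shows "laplace_moebius T 0 = of_real (log_moebius_sum (exp T))"
  unfolding laplace_moebius_eq[OF assms] log_moebius_sum_def of_real_sum
proof (intro sum.cong refl)
  fix k assume k: "k \<in> {1..nat \<lfloor>exp T\<rfloor>}"
  hence "ln (real k) \<le> T" using le_nat_floor_exp_iff by auto
  moreover have "ln (exp T / real k) = T - ln (real k)" using k by (simp add: ln_div)
  ultimately show "of_real (moebius k / real k) * integral {ln (real k)..T} (\<lambda>t. exp (- (0 * of_real t))) =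
      complex_of_real (moebius k / real k * ln (exp T / real k))"
    by (simp add: scaleR_conv_of_real)
qed

section \<open>Limits of the weighted and the plain sums\<close>

lemma log_moebius_sum_tendsto: "(log_moebius_sum \<longlongrightarrow> 1) at_top"
proof -
  \<comment> \<open>Nonvanishing is an open condition, so no explicit zero-free region is needed:
    this set is open, and it contains the closed half plane by
    \<open>reg_zeta_nonzero\<close>.\<close>
  define \<Omega> where "\<Omega> = {z. Re z > -1 \<and> reg_zeta (1 + z) \<noteq> 0}"
  have hol: "(\<lambda>z. reg_zeta (1 + z)) holomorphic_on {z. Re z > -1}"
    by (rule holomorphic_on_compose_gen[OF _ reg_zeta_holomorphic, unfolded o_def])
       (auto intro!: holomorphic_intros)
  have "open ({z. Re z > -1} \<inter> (\<lambda>z. reg_zeta (1 + z)) -` (- {0}))"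
    by (intro continuous_open_preimage holomorphic_on_imp_continuous_on[OF hol] open_halfspace_Re_gt) auto
  hence "open \<Omega>" by (simp add: \<Omega>_def Int_def vimage_def)
  have "((\<lambda>T. laplace_moebius T 0) \<longlongrightarrow> 1 / reg_zeta (1 + 0)) at_top"
  proof (rule newman_analytic[where B = 1 and \<Omega> = \<Omega>])
    show "(\<lambda>z. 1 / reg_zeta (1 + z)) holomorphic_on \<Omega>"
      by (intro holomorphic_intros holomorphic_on_subset[OF hol]) (auto simp: \<Omega>_def)
    show "{z. 0 \<le> Re z} \<subseteq> \<Omega>"
      using reg_zeta_nonzero by (auto simp: \<Omega>_def)
    show "laplace_moebius T holomorphic_on UNIV" if "T > 0" for T
      using that by (intro laplace_moebius_holomorphic) auto
    fix T :: real and z :: complex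
    assume T: "T > 0"
    show "norm (laplace_moebius T z) \<le> 1 * exp (- T * Re z) / - Re z" if "Re z < 0"
    proof -
      \<comment> \<open>Comparison with the transform truncated at 0, which is an empty
        integral.\<close>
      have "norm (laplace_moebius T z) \<le> (1 - exp (- (Re z * T))) / Re z"
        using laplace_moebius_diff_le[of 0 T z] T that by (simp add: laplace_moebius_def)
      also have "\<dots> \<le> exp (- T * Re z) / - Re z"
        using that by (simp add: field_simps)
      finally show ?thesis by simp
    qed
    show "norm (laplace_moebius T z - 1 / reg_zeta (1 + z)) \<le> 1 * exp (- T * Re z) / Re z" if "Re z > 0"
    proof (rule tendsto_upperbound)
      show "((\<lambda>T'. norm (laplace_moebius T z - laplace_moebius T' z)) \<longlongrightarrow> norm (laplace_moebius T z - 1 / reg_zeta (1 + z))) at_top"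
        by (intro tendsto_intros laplace_moebius_tendsto that)
      show "eventually (\<lambda>T'. norm (laplace_moebius T z - laplace_moebius T' z) \<le> 1 * exp (- T * Re z) / Re z) at_top"
        using eventually_ge_at_top[of T]
      proof eventually_elim
        case (elim T')
        have "norm (laplace_moebius T z - laplace_moebius T' z) \<le> (exp (- (Re z * T)) - exp (- (Re z * T'))) / Re z"
          using laplace_moebius_diff_le[of T T' z] T elim that by (simp add: norm_minus_commute)
        also have "\<dots> \<le> 1 * exp (- T * Re z) / Re z"
          using that by (simp add: divide_right_mono mult.commute)
        finally show ?case .
      qed
    qed simp
  qed fact
  hence "((\<lambda>T. laplace_moebius T 0) \<longlongrightarrow> of_real 1) at_top" by simp
  hence "((\<lambda>T. complex_of_real (log_moebius_sum (exp T))) \<longlongrightarrow> of_real 1) at_top"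
    by (rule Lim_transform_eventually)
       (auto intro!: eventually_mono[OF eventually_ge_at_top[of 0]] simp: laplace_moebius_0)
  hence "((\<lambda>T. log_moebius_sum (exp T)) \<longlongrightarrow> 1) at_top"
    by (simp only: tendsto_of_real_iff)
  hence "((\<lambda>x. log_moebius_sum (exp (ln x))) \<longlongrightarrow> 1) at_top"
    by (rule filterlim_compose[OF _ ln_at_top])
  thus ?thesis
    by (rule Lim_transform_eventually) (auto intro!: eventually_mono[OF eventually_gt_at_top[of 0]])
qed

lemma moebius_sum_tendsto: "(moebius_sum \<longlongrightarrow> 0) at_top"
proof (rule tendstoI)
  fix \<epsilon> :: real assume \<epsilon>: "\<epsilon> > 0"
  \<comment> \<open>The bound below tends to \<delta>, which has to lie strictly under \<epsilon>.
    In logarithmic scale the step from x to (1 + \<delta>) x has length l.\<close>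
  define \<delta> where "\<delta> = \<epsilon> / 2"
  define l where "l = ln (1 + \<delta>)"
  have \<delta>: "\<delta> > 0" and l: "l > 0" using \<epsilon> by (auto simp: \<delta>_def l_def)
  define D where "D = (\<lambda>x. log_moebius_sum ((1 + \<delta>) * x) - log_moebius_sum x)"
  have bound: "\<bar>moebius_sum x\<bar> \<le> \<bar>D x\<bar> / l + \<delta> + 1 / x" if x: "x \<ge> 1" for x
  proof -
    let ?a = "\<lambda>k. real_of_int (moebius k) / real k"
    define n where "n = nat \<lfloor>x\<rfloor>"
    define n' where "n' = nat \<lfloor>(1 + \<delta>) * x\<rfloor>"
    have xx: "x \<le> (1 + \<delta>) * x" using x \<delta> by simp
    have nn: "n \<le> n'" unfolding n_def n'_def using xx by (intro nat_mono floor_mono)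
    \<comment> \<open>Passing from x to (1 + \<delta>) x adds l to the logarithm in every old term,
      which produces l * \<open>moebius_sum x\<close>, and creates these new terms. There are at
      most \<delta> x + 1 of them, each at most l / x, so that after division by l they cost
      \<delta> + 1 / x.\<close>
    let ?E = "\<Sum>k\<in>{n<..n'}. ?a k * ln ((1 + \<delta>) * x / real k)"
    have "{1..n'} = {1..n} \<union> {n<..n'}" using nn by auto
    hence "log_moebius_sum ((1 + \<delta>) * x) = (\<Sum>k = 1..n. ?a k * ln ((1 + \<delta>) * x / real k)) + ?E"
      unfolding log_moebius_sum_def n'_def[symmetric] by (simp only:) (rule sum.union_disjoint, auto)
    also have "(\<Sum>k = 1..n. ?a k * ln ((1 + \<delta>) * x / real k)) = (\<Sum>k = 1..n. ?a k * ln (x / real k)) + (\<Sum>k = 1..n. ?a k * l)"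
      unfolding sum.distrib[symmetric]
    proof (intro sum.cong refl)
      fix k assume "k \<in> {1..n}"
      hence "ln ((1 + \<delta>) * (x / real k)) = l + ln (x / real k)"
        unfolding l_def using x \<delta> by (intro ln_mult_pos) auto
      thus "?a k * ln ((1 + \<delta>) * x / real k) = ?a k * ln (x / real k) + ?a k * l"
        by (simp add: distrib_left)
    qed
    also have "\<dots> = log_moebius_sum x + l * moebius_sum x"
      by (simp add: log_moebius_sum_def moebius_sum_def n_def sum_distrib_left mult.commute)
    finally have "l * moebius_sum x = D x - ?E" by (simp add: D_def)
    hence "l * \<bar>moebius_sum x\<bar> = \<bar>D x - ?E\<bar>" using l by (metis abs_mult abs_of_pos)
    also have "\<dots> \<le> \<bar>D x\<bar> + \<bar>?E\<bar>" by simp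
    also have "\<bar>?E\<bar> \<le> (\<Sum>k\<in>{n<..n'}. 1 / x * l)"
    proof (rule order.trans[OF sum_abs], rule sum_mono)
      fix k assume k: "k \<in> {n<..n'}"
      have kx: "real k > x" using k unfolding n_def by simp linarith
      have kx': "real k \<le> (1 + \<delta>) * x" using k xx x unfolding n'_def by (simp add: le_nat_iff le_floor_iff)
      have "\<bar>real_of_int (moebius k)\<bar> \<le> 1" using abs_moebius_le_1[of k] by linarith
      hence "\<bar>?a k\<bar> \<le> 1 / real k" by (simp add: divide_right_mono)
      also have "\<dots> \<le> 1 / x" using kx x by (intro divide_left_mono) auto
      finally have 1: "\<bar>?a k\<bar> \<le> 1 / x" .
      have "(1 + \<delta>) * x \<le> (1 + \<delta>) * real k" using kx \<delta> by (intro mult_left_mono) auto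
      hence "(1 + \<delta>) * x / real k \<le> 1 + \<delta>" using kx x by (simp add: divide_le_eq)
      moreover have "1 \<le> (1 + \<delta>) * x / real k" using kx kx' x by (simp add: field_simps)
      ultimately have "\<bar>ln ((1 + \<delta>) * x / real k)\<bar> \<le> l" unfolding l_def by simp
      with 1 show "\<bar>?a k * ln ((1 + \<delta>) * x / real k)\<bar> \<le> 1 / x * l"
        unfolding abs_mult using x by (intro mult_mono) auto
    qed
    also have "\<dots> = (real n' - real n) * (1 / x * l)" using nn by (simp add: of_nat_diff)
    also have "\<dots> \<le> (\<delta> * x + 1) * (1 / x * l)"
    proof (rule mult_right_mono)
      have "real n' \<le> (1 + \<delta>) * x" using x xx unfolding n'_def by simp
      moreover have "real n > x - 1" unfolding n_def using x by simp
      ultimately show "real n' - real n \<le> \<delta> * x + 1" by (simp add: algebra_simps)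
    qed (use x l in auto)
    finally have "l * \<bar>moebius_sum x\<bar> \<le> \<bar>D x\<bar> + (\<delta> * x + 1) * (1 / x * l)" by simp
    thus ?thesis using x l by (simp add: field_simps)
  qed
  have "filterlim (\<lambda>x. (1 + \<delta>) * x) at_top at_top"
    using \<delta> by (intro filterlim_tendsto_pos_mult_at_top[OF tendsto_const] filterlim_ident) auto
  from filterlim_compose[OF log_moebius_sum_tendsto this]
  have "(D \<longlongrightarrow> 1 - 1) at_top"
    unfolding D_def by (intro tendsto_diff log_moebius_sum_tendsto)
  hence "((\<lambda>x. \<bar>D x\<bar> / l + \<delta> + 1 / x) \<longlongrightarrow> \<bar>1 - 1\<bar> / l + \<delta> + 0) at_top"
    using l by (intro tendsto_intros tendsto_divide_0[OF tendsto_const] filterlim_at_top_imp_at_infinity filterlim_ident) auto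
  hence "eventually (\<lambda>x. \<bar>D x\<bar> / l + \<delta> + 1 / x < \<epsilon>) at_top"
    by (rule order_tendstoD(2)) (use \<epsilon> in \<open>simp add: \<delta>_def\<close>)
  with eventually_ge_at_top[of 1] show "eventually (\<lambda>x. dist (moebius_sum x) 0 < \<epsilon>) at_top"
    by eventually_elim (use bound in \<open>force simp: dist_norm\<close>)
qed

section \<open>The hyperbola method\<close>

text \<open>With n the floor of y the error is at most 1 / n, and y < n + 1 \<le> 2 n turns this
  into a bound in y.\<close>

lemma harm_nat_floor_approx:
  fixes y :: real
  assumes y: "y \<ge> 1"
  shows "\<bar>harm (nat \<lfloor>y\<rfloor>) - (ln y + euler_mascheroni)\<bar> \<le> 2 / y"
proof -
  define n where "n = nat \<lfloor>y\<rfloor>"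
  have n: "n \<ge> 1" "real n \<le> y" "y < real n + 1"
    using y unfolding n_def by (auto simp: le_nat_iff)
  have em: "harm n - ln (real n + 1) + 1 / (2 * (real n + 1)) \<le> euler_mascheroni"
           "euler_mascheroni \<le> harm n - ln (real n + 1) + 1 / (2 * real n)"
    using euler_mascheroni_bounds[OF n(1)] by (auto simp: inverse_eq_divide add_ac)
  have "ln y \<le> ln (real n + 1)" using n y by simp
  moreover have "ln (real n + 1) - ln (real n) \<le> 1 / real n"
    using ln_diff_le_inverse[of "real n"] n by simp
  moreover have "ln (real n) \<le> ln y" using n by simp
  moreover have "0 \<le> 1 / (2 * (real n + 1))" by simp
  moreover have "1 / (2 * real n) \<le> 1 / real n" using n by (simp add: field_simps)
  ultimately have "\<bar>harm n - (ln y + euler_mascheroni)\<bar> \<le> 1 / real n"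
    using em by linarith
  also have "1 / real n \<le> 2 / y"
  proof -
    have "real n \<ge> 1" using n(1) by simp
    hence "y \<le> 2 * real n" using n(3) by linarith
    hence "2 / (2 * real n) \<le> 2 / y" using y by (intro divide_left_mono) auto
    thus ?thesis by simp
  qed
  finally show ?thesis by (simp add: n_def)
qed

lemma sum_inverse_sqrt_le: "(\<Sum>k = 1..n. 1 / sqrt (real k)) \<le> 2 * sqrt (real n)"
proof (induction n)
  case (Suc n)
  have "1 / sqrt (real (Suc n)) \<le> 2 * (sqrt (real (Suc n)) - sqrt (real n))"
  proof -
    define a where "a = sqrt (real (Suc n))"
    define b where "b = sqrt (real n)"
    have ab: "a > 0" "b \<ge> 0" "b \<le> a" "a\<^sup>2 = b\<^sup>2 + 1" by (simp_all add: a_def b_def)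
    have "1 = (a - b) * (a + b)" using ab by (simp add: power2_eq_square algebra_simps)
    also have "\<dots> \<le> (a - b) * (2 * a)" using ab by (intro mult_left_mono) auto
    finally show ?thesis using ab unfolding a_def[symmetric] b_def[symmetric] by (simp add: field_simps)
  qed
  thus ?case using Suc.IH by simp
qed simp

lemma moebius_sum_of_nat_div:
  "moebius_sum (real N / real d) = (\<Sum>k = 1..N div d. real_of_int (moebius k) / real k)"
  by (simp add: moebius_sum_def floor_divide_of_nat_eq)

lemma sum_c_eq:
  "(\<Sum>n = 1..N. real_of_int (c n) / real n) =
     (\<Sum>(m, k) | m > 0 \<and> k > 0 \<and> m\<^sup>2 * k \<le> N. real_of_int (moebius k) / (real m * real k))"
proof -
  let ?Q = "{(m, k). m > 0 \<and> k > 0 \<and> m\<^sup>2 * k \<le> N}"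
  have fin: "finite ?Q"
  proof (rule finite_subset)
    have "m \<le> N \<and> k \<le> N" if "m > 0" "k > 0" "m\<^sup>2 * k \<le> N" for m k :: nat
    proof
      have "m * 1 \<le> m * (m * k)" using that by (intro mult_le_mono) (auto simp: Suc_le_eq)
      also have "\<dots> = m\<^sup>2 * k" by (simp add: power2_eq_square)
      also note that(3)
      finally show "m \<le> N" by simp
      have "1 * k \<le> m\<^sup>2 * k" using that by (intro mult_le_mono) (auto simp: Suc_le_eq)
      also note that(3)
      finally show "k \<le> N" by simp
    qed
    thus "?Q \<subseteq> {..N} \<times> {..N}" by auto
  qed simp
  have "(\<Sum>(m, k)\<in>?Q. real_of_int (moebius k) / (real m * real k)) =
      (\<Sum>(m, k)\<in>{(m, k) \<in> ?Q. squarefree k}. real_of_int (moebius k) / (real m * real k))"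
    by (rule sum.mono_neutral_right[OF fin]) (auto simp: moebius_def split: if_splits)
  also have "\<dots> = (\<Sum>n = 1..N. real_of_int (c n) / real n)"
  proof (rule sum.reindex_bij_witness[of _ "\<lambda>n. (square_part n, squarefree_part n)" "\<lambda>(m, k). m\<^sup>2 * k"])
    fix x assume x: "x \<in> {(m, k) \<in> ?Q. squarefree k}"
    obtain m k where mk: "x = (m, k)" "m > 0" "k > 0" "m\<^sup>2 * k \<le> N" "squarefree k" using x by auto
    have "square_part (m\<^sup>2 * k) = m" using mk by (simp add: square_part_mult_squarefree)
    moreover have "squarefree_part (m\<^sup>2 * k) = k"
      using squarefree_decompose[of "m\<^sup>2 * k"] mk by (simp add: square_part_mult_squarefree)
    ultimately show "(square_part (case x of (m, k) \<Rightarrow> m\<^sup>2 * k), squarefree_part (case x of (m, k) \<Rightarrow> m\<^sup>2 * k)) = x"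
      using mk by simp
    show "(case x of (m, k) \<Rightarrow> m\<^sup>2 * k) \<in> {1..N}" using mk by (simp add: Suc_le_eq)
    show "real_of_int (c (case x of (m, k) \<Rightarrow> m\<^sup>2 * k)) / real (case x of (m, k) \<Rightarrow> m\<^sup>2 * k) =
        (case x of (m, k) \<Rightarrow> real_of_int (moebius k) / (real m * real k))"
      using mk c_mult_squarefree[of k m] by (simp add: power2_eq_square)
  next
    fix n assume n: "n \<in> {1..N}"
    have dec: "(square_part n)\<^sup>2 * squarefree_part n = n"
      using squarefree_decompose[of n] by (simp add: mult.commute)
    thus "(case (square_part n, squarefree_part n) of (m, k) \<Rightarrow> m\<^sup>2 * k) = n" by simp
    have "square_part n > 0" "squarefree_part n > 0" using n dec by (auto intro!: Nat.gr0I)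
    thus "(square_part n, squarefree_part n) \<in> {(m, k) \<in> ?Q. squarefree k}" using n dec by simp
  qed
  finally show ?thesis by simp
qed

text \<open>
  Dirichlet's hyperbola method: \<open>k \<le> N / M\<^sup>2\<close> is summed over \<open>m\<close> first, and
  \<open>k > N / M\<^sup>2\<close>, which forces \<open>m < M\<close>, over \<open>k\<close> first.
\<close>

lemma sum_c_split:
  assumes M: "M > 0"
  shows "(\<Sum>n = 1..N. real_of_int (c n) / real n) =
    (\<Sum>k = 1..N div M\<^sup>2. real_of_int (moebius k) / real k * harm (nat \<lfloor>sqrt (real N / real k)\<rfloor>)) +
    (\<Sum>m = 1..<M. (moebius_sum (real N / real (m\<^sup>2)) - moebius_sum (real N / real (M\<^sup>2))) / real m)"
proof -
  let ?a = "\<lambda>k. real_of_int (moebius k) / real k"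
  let ?g = "\<lambda>(m, k). real_of_int (moebius k) / (real m * real k)"
  let ?Q1 = "SIGMA k:{1..N div M\<^sup>2}. {1..nat \<lfloor>sqrt (real N / real k)\<rfloor>}"
  let ?Q2 = "SIGMA m:{1..<M}. {N div M\<^sup>2<..N div m\<^sup>2}"
  have le_sqrt: "m \<le> nat \<lfloor>sqrt (real N / real k)\<rfloor> \<longleftrightarrow> m\<^sup>2 * k \<le> N" if "k > 0" for m k
  proof -
    have "m \<le> nat \<lfloor>sqrt (real N / real k)\<rfloor> \<longleftrightarrow> real m \<le> sqrt (real N / real k)"
      by (simp add: le_nat_iff le_floor_iff)
    also have "\<dots> \<longleftrightarrow> (real m)\<^sup>2 \<le> real N / real k"
      by (metis of_nat_0_le_iff real_le_rsqrt real_sqrt_le_iff real_sqrt_unique)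
    also have "\<dots> \<longleftrightarrow> real (m\<^sup>2 * k) \<le> real N" using that by (simp add: field_simps)
    finally show ?thesis by (simp only: of_nat_le_iff)
  qed
  have le_div: "k \<le> N div d\<^sup>2 \<longleftrightarrow> d\<^sup>2 * k \<le> N" if "d > 0" for d k
    using that by (simp add: less_eq_div_iff_mult_less_eq mult.commute)
  have "{(m, k). m > 0 \<and> k > 0 \<and> m\<^sup>2 * k \<le> N} = prod.swap ` ?Q1 \<union> ?Q2"
  proof (intro equalityI subsetI)
    fix x assume "x \<in> {(m, k). m > 0 \<and> k > 0 \<and> m\<^sup>2 * k \<le> N}"
    then obtain m k where x: "x = (m, k)" "m > 0" "k > 0" "m\<^sup>2 * k \<le> N" by auto
    show "x \<in> prod.swap ` ?Q1 \<union> ?Q2"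
    proof (cases "M\<^sup>2 * k \<le> N")
      case True
      hence "(k, m) \<in> ?Q1" using x M le_sqrt le_div by (simp add: Suc_le_eq)
      thus ?thesis using x by force
    next
      case False
      hence "m\<^sup>2 * k < M\<^sup>2 * k" using x by linarith
      hence "m < M" by (auto intro: power2_less_imp_less)
      thus ?thesis using x False le_div[OF M, of k] le_div[OF x(2), of k] by simp
    qed
  next
    fix x assume "x \<in> prod.swap ` ?Q1 \<union> ?Q2"
    thus "x \<in> {(m, k). m > 0 \<and> k > 0 \<and> m\<^sup>2 * k \<le> N}"
      using le_sqrt le_div by auto
  qed
  moreover have "prod.swap ` ?Q1 \<inter> ?Q2 = {}" by auto
  ultimately have "(\<Sum>n = 1..N. real_of_int (c n) / real n) = sum ?g (prod.swap ` ?Q1) + sum ?g ?Q2"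
    unfolding sum_c_eq by (simp only:) (rule sum.union_disjoint, auto)
  also have "sum ?g (prod.swap ` ?Q1) = (\<Sum>(k, m)\<in>?Q1. ?a k * (1 / real m))"
    by (subst sum.reindex) (auto simp: inj_on_def intro!: sum.cong)
  also have "\<dots> = (\<Sum>k = 1..N div M\<^sup>2. \<Sum>m = 1..nat \<lfloor>sqrt (real N / real k)\<rfloor>. ?a k * (1 / real m))"
    by (rule sum.Sigma[symmetric]) auto
  also have "\<dots> = (\<Sum>k = 1..N div M\<^sup>2. ?a k * harm (nat \<lfloor>sqrt (real N / real k)\<rfloor>))"
    by (simp add: harm_def sum_distrib_left inverse_eq_divide)
  also have "sum ?g ?Q2 = (\<Sum>m = 1..<M. \<Sum>k\<in>{N div M\<^sup>2<..N div m\<^sup>2}. real_of_int (moebius k) / (real m * real k))"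
    by (rule sum.Sigma[symmetric]) auto
  also have "\<dots> = (\<Sum>m = 1..<M. (moebius_sum (real N / real (m\<^sup>2)) - moebius_sum (real N / real (M\<^sup>2))) / real m)"
  proof (intro sum.cong refl)
    fix m assume m: "m \<in> {1..<M}"
    have "N div M\<^sup>2 \<le> N div m\<^sup>2" using m by (intro div_le_mono2 power_mono) auto
    hence "{1..N div m\<^sup>2} = {1..N div M\<^sup>2} \<union> {N div M\<^sup>2<..N div m\<^sup>2}" by auto
    hence "moebius_sum (real N / real (m\<^sup>2)) = moebius_sum (real N / real (M\<^sup>2)) + sum ?a {N div M\<^sup>2<..N div m\<^sup>2}"
      unfolding moebius_sum_of_nat_div by (simp only:) (rule sum.union_disjoint, auto)
    thus "(\<Sum>k\<in>{N div M\<^sup>2<..N div m\<^sup>2}. real_of_int (moebius k) / (real m * real k)) =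
        (moebius_sum (real N / real (m\<^sup>2)) - moebius_sum (real N / real (M\<^sup>2))) / real m"
      by (simp add: sum_divide_distrib mult.commute)
  qed
  finally show ?thesis .
qed

text \<open>With y = sqrt (N / k), ln y is half of ln (N / (M^2 k)) plus ln M, so the harmonic sums
  produce both Moebius sums at N / M^2. The error 2 / y in the term of index k carries the weight 1
  / k; summed over k \<le> N / M^2 this is at most 2 / sqrt N times 2 sqrt (N / M^2), in which N
  cancels.\<close>

lemma sum_c_approx:
  assumes M: "M > 0" and N: "N > 0"
  shows "\<bar>(\<Sum>n = 1..N. real_of_int (c n) / real n) -
    (log_moebius_sum (real N / real (M\<^sup>2)) / 2 + (ln (real M) + euler_mascheroni) * moebius_sum (real N / real (M\<^sup>2)) +
     (\<Sum>m = 1..<M. (moebius_sum (real N / real (m\<^sup>2)) - moebius_sum (real N / real (M\<^sup>2))) / real m))\<bar> \<le> 4 / real M"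
proof -
  let ?a = "\<lambda>k. real_of_int (moebius k) / real k"
  let ?K = "N div M\<^sup>2"
  let ?y = "\<lambda>k. sqrt (real N / real k)"
  let ?h = "\<lambda>k. harm (nat \<lfloor>?y k\<rfloor>)"
  have "log_moebius_sum (real N / real (M\<^sup>2)) / 2 + (ln (real M) + euler_mascheroni) * moebius_sum (real N / real (M\<^sup>2)) =
      (\<Sum>k = 1..?K. ?a k * ln (real N / real (M\<^sup>2) / real k) / 2 + (ln (real M) + euler_mascheroni) * ?a k)"
    by (simp add: log_moebius_sum_def moebius_sum_of_nat_div floor_divide_of_nat_eq sum.distrib
        sum_distrib_left sum_divide_distrib del: of_nat_power)
  also have "\<dots> = (\<Sum>k = 1..?K. ?a k * (ln (?y k) + euler_mascheroni))"
  proof (intro sum.cong refl)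
    fix k assume "k \<in> {1..?K}"
    hence "real k > 0" by simp
    hence "ln (real N / real (M\<^sup>2) / real k) = 2 * ln (?y k) - 2 * ln (real M)"
      using M N by (simp add: ln_div ln_mult ln_sqrt ln_realpow)
    thus "?a k * ln (real N / real (M\<^sup>2) / real k) / 2 + (ln (real M) + euler_mascheroni) * ?a k =
        ?a k * (ln (?y k) + euler_mascheroni)" 
      by (simp only:) (simp add: algebra_simps add_divide_distrib diff_divide_distrib)
  qed
  finally have "\<bar>(\<Sum>n = 1..N. real_of_int (c n) / real n) -
    (log_moebius_sum (real N / real (M\<^sup>2)) / 2 + (ln (real M) + euler_mascheroni) * moebius_sum (real N / real (M\<^sup>2)) +
     (\<Sum>m = 1..<M. (moebius_sum (real N / real (m\<^sup>2)) - moebius_sum (real N / real (M\<^sup>2))) / real m))\<bar> =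
     \<bar>\<Sum>k = 1..?K. ?a k * (?h k - (ln (?y k) + euler_mascheroni))\<bar>"
    unfolding sum_c_split[OF M] by (simp add: sum_subtractf right_diff_distrib)
  also have "\<dots> \<le> (\<Sum>k = 1..?K. 2 / sqrt (real N) * (1 / sqrt (real k)))"
  proof (rule order.trans[OF sum_abs], rule sum_mono)
    fix k assume k: "k \<in> {1..?K}"
    have "k \<le> N" using k by (auto intro: order.trans[OF _ div_le_dividend])
    hence y: "?y k \<ge> 1" using k by simp
    have "\<bar>real_of_int (moebius k)\<bar> \<le> 1" using abs_moebius_le_1[of k] by linarith
    hence "\<bar>?a k\<bar> \<le> 1 / real k" by (simp add: divide_right_mono)
    hence "\<bar>?a k * (?h k - (ln (?y k) + euler_mascheroni))\<bar> \<le> 1 / real k * (2 / ?y k)"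
      unfolding abs_mult by (rule mult_mono) (use harm_nat_floor_approx[OF y] in auto)
    also have "\<dots> = 2 / sqrt (real N) * (1 / sqrt (real k))"
      using k N by (simp add: real_sqrt_divide field_simps)
    finally show "\<bar>?a k * (?h k - (ln (?y k) + euler_mascheroni))\<bar> \<le> 2 / sqrt (real N) * (1 / sqrt (real k))" .
  qed
  also have "\<dots> = 2 / sqrt (real N) * (\<Sum>k = 1..?K. 1 / sqrt (real k))"
    by (simp add: sum_distrib_left)
  also have "\<dots> \<le> 2 / sqrt (real N) * (2 * sqrt (real ?K))"
    by (intro mult_left_mono sum_inverse_sqrt_le) auto
  also have "real ?K \<le> real N / (real M)\<^sup>2" using of_nat_div_le_of_nat[of N "M\<^sup>2", where ?'a = real] by simp
  hence "2 / sqrt (real N) * (2 * sqrt (real ?K)) \<le> 2 / sqrt (real N) * (2 * sqrt (real N / (real M)\<^sup>2))"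
    by (intro mult_left_mono) auto
  also have "\<dots> = 4 / real M" using N M by (simp add: real_sqrt_divide)
  finally show ?thesis .
qed

theorem theorem4p1:
  shows "(\<lambda>n. real_of_int (c (Suc n)) / real (Suc n)) sums (1 / 2)"
proof -
  let ?S = "\<lambda>N. \<Sum>n = 1..N. real_of_int (c n) / real n"
  have "?S \<longlonglongrightarrow> 1 / 2"
  proof (rule tendstoI)
    fix \<epsilon> :: real assume \<epsilon>: "\<epsilon> > 0"
    \<comment> \<open>Brings the error 4 / M of \<open>sum_c_approx\<close> below \<epsilon> / 2; M
      stays fixed while N grows.\<close>
    obtain M where M: "real M > 8 / \<epsilon>" using reals_Archimedean2 by blast
    have "real M > 0" using M \<epsilon> by (meson divide_pos_pos less_trans zero_less_numeral)
    hence M0: "M > 0" by simp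
    have ME: "4 / real M < \<epsilon> / 2" using M M0 \<epsilon> by (simp add: field_simps)
    define R where "R = (\<lambda>N. log_moebius_sum (real N / real (M\<^sup>2)) / 2 +
      (ln (real M) + euler_mascheroni) * moebius_sum (real N / real (M\<^sup>2)) +
      (\<Sum>m = 1..<M. (moebius_sum (real N / real (m\<^sup>2)) - moebius_sum (real N / real (M\<^sup>2))) / real m))"
    have lim: "filterlim (\<lambda>N. real N / real (m\<^sup>2)) at_top sequentially" if "m > 0" for m
      using that filterlim_tendsto_pos_mult_at_top[OF tendsto_const _ filterlim_real_sequentially, of "1 / real (m\<^sup>2)"]
      by (simp add: field_simps)
    have P: "(\<lambda>N. log_moebius_sum (real N / real (M\<^sup>2))) \<longlonglongrightarrow> 1"
      by (rule filterlim_compose[OF log_moebius_sum_tendsto lim[OF M0]])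
    have Q: "(\<lambda>N. moebius_sum (real N / real (m\<^sup>2))) \<longlonglongrightarrow> 0" if "m > 0" for m
      by (rule filterlim_compose[OF moebius_sum_tendsto lim[OF that]])
    have "R \<longlonglongrightarrow> 1 / 2 + (ln (real M) + euler_mascheroni) * 0 + (\<Sum>m = 1..<M. (0 - 0) / real m)"
      unfolding R_def by (intro tendsto_intros P Q M0) auto
    hence "R \<longlonglongrightarrow> 1 / 2" by simp
    hence "eventually (\<lambda>N. dist (R N) (1 / 2) < \<epsilon> / 2) sequentially"
      using \<epsilon> by (intro tendstoD) auto
    with eventually_gt_at_top[of 0] show "eventually (\<lambda>N. dist (?S N) (1 / 2) < \<epsilon>) sequentially"
    proof eventually_elim
      case (elim N)
      have "dist (?S N) (R N) \<le> 4 / real M"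
        unfolding dist_norm real_norm_def R_def by (rule sum_c_approx[OF M0 elim(1)])
      thus ?case using elim(2) ME dist_triangle[of "?S N" "1 / 2" "R N"] by linarith
    qed
  qed
  moreover have "(\<Sum>n<N. real_of_int (c (Suc n)) / real (Suc n)) = ?S N" for N
    by (rule sum.reindex_bij_witness[of _ "\<lambda>n. n - 1" Suc]) auto
  ultimately show ?thesis by (simp only: sums_def)
qed

end
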